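(* With probability at least $1-\alpha$ with respect to the sampling, the family $\{\mathcal{U}^{LCX}_\epsilon:0<\epsilon<1\}$ simultaneously implies a probabilistic guarantee for $\mathbb{P}^*$, where $$\mathcal{U}^{LCX}_\epsilon=\Big\{\mathbf{u}\in\mathbb{R}^d:\exists\,\mathbf{r}\in\mathbb{R}^d,\ 1\le z\le1/\epsilon,\ \text{s.t. }(\mathbf{a}^T\mathbf{r}-b(z-1))^++(\mathbf{a}^T\mathbf{u}-b)^+\le \frac{z}{N}\sum_{j=1}^N(\mathbf{a}^T\hat{\mathbf{u}}_j-b)^++\Gamma_{LCX}\ \ \forall(\mathbf{a},b)\in\mathcal{B}\Big\}.$$ Moreover, $$\delta^*(\mathbf{v}\mid\mathcal{U}^{LCX}_\epsilon)=\sup_{\mathbb{P}\in\mathcal{P}^{LCX}}\mathrm{VaR}^{\mathbb{P}}_\epsilon(\mathbf{v})=\min_{\tau,\theta,y_1,y_2,\lambda}\ \frac1\epsilon\tau-\theta-\int_{\mathcal{B}}b\,dy_1(\mathbf{a},b)+\int_{\mathcal{B}}b\,dy_2(\mathbf{a},b)$$ subject to $$\theta+\int_{\mathcal{B}}b\,dy_1(\mathbf{a},b)+\int_{\mathcal{B}}\Gamma(\mathbf{a},b)\,d\lambda(\mathbf{a},b)\le\tau,$$ $$0\le dy_1(\mathbf{a},b)\le d\lambda(\mathbf{a},b),\quad0\le dy_2(\mathbf{a},b)\le d\lambda(\mathbf{a},b)\quad\forall(\mathbf{a},b)\in\mathcal{B},$$ $$\int_{\mathcal{B}}\mathbf{a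}\,dy_1(\mathbf{a},b)=\mathbf{0},\quad\mathbf{v}=\int_{\mathcal{B}}\mathbf{a}\,dy_2(\mathbf{a},b),\quad\theta,\tau\ge0.$$
   Context: $0<\alpha<1$, $0<\epsilon<1$; $\mathcal{S}=\{\hat{\mathbf{u}}_1,\dots,\hat{\mathbf{u}}_N\}$ is drawn i.i.d. from the unknown measure $\mathbb{P}^*$ on $\mathbb{R}^d$ (possibly with unbounded support); $\tilde{\mathbf{u}}$ is a random vector; $\|\cdot\|$ is the Euclidean norm and $(x)^+=\max(x,0)$. $\mathcal{B}=\{(\mathbf{a},b)\in\mathbb{R}^d\times\mathbb{R}:\|\mathbf{a}\|_1+|b|\le1\}$. $\Gamma_{LCX}>0$ and $\Gamma_\sigma$ are the thresholds of a goodness-of-fit test based on linear-convex ordering, which rejects the null hypothesis $\mathbb{P}^*=\mathbb{P}_0$ if $\mathbb{E}^{\mathbb{P}_0}[(\mathbf{a}^T\tilde{\mathbf{u}}-b)^+]-\frac1N\sum_{j=1}^N(\mathbf{a}^T\hat{\mathbf{u}}_j-b)^+>\Gamma_{LCX}$ for some $(\mathbf{a},b)\in\mathcal{B}$, or if $\frac1N\sum_{j=1}^N\|\hat{\mathbf{u}}_j\|^2-\mathbb{E}^{\mathbb{P}_0}[\|\tilde{\mathbf{u}}\|^2]>\Gamma_\sigma$. Write $\Gamma(\mathbf{a},b)=\frac1N\sum_{j=1}^N(\mathbf{a}^T\hat{\mathbf{u}}_j-b)^++\Gamma_{LCX}$. The confidence region of the test is $$\mathcal{P}^{LCX}=\Big\{\mathbb{P}\text{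 Borel probability on }\mathbb{R}^d:\ \mathbb{E}^{\mathbb{P}}[(\mathbf{a}^T\tilde{\mathbf{u}}-b)^+]\le\Gamma(\mathbf{a},b)\ \forall(\mathbf{a},b)\in\mathcal{B},\ \ \mathbb{E}^{\mathbb{P}}[\|\tilde{\mathbf{u}}\|^2]\ge\frac1N\sum_{j=1}^N\|\hat{\mathbf{u}}_j\|^2-\Gamma_\sigma\Big\}.$$ The thresholds are such that the test is valid at level $\alpha$, i.e. $\mathbb{P}^*\in\mathcal{P}^{LCX}$ with probability at least $1-\alpha$ with respect to the sampling. In the minimization, $\tau,\theta\in\mathbb{R}$ and $y_1,y_2,\lambda$ are measures on $\mathcal{B}$; $0\le dy_i\le d\lambda$ means $0\le y_i(A)\le\lambda(A)$ for all Borel $A\subseteq\mathcal{B}$. $\mathrm{VaR}_\epsilon^{\mathbb{P}}(\mathbf{v})=\inf\{t:\mathbb{P}(\tilde{\mathbf{u}}^T\mathbf{v}\le t)\ge1-\epsilon\}$; $\delta^*(\mathbf{v}\mid\mathcal{U})=\sup_{\mathbf{u}\in\mathcal{U}}\mathbf{v}^T\mathbf{u}$. A set $\mathcal{U}$ implies a probabilistic guarantee for $\mathbb{P}^*$ at level $\epsilon$ if for every $\mathbf{x}^*\in\mathbb{R}^k$ and every function $f(\mathbf{u},\mathbf{x})$ concave in $\mathbf{u}$ for all $\mathbf{x}$: $f(\mathbf{u},\mathbf{x}^* )\le0\ \forall\mathbf{u}\in\mathcal{U}$ implies $\mathbb{P}^*(f(\tilde{\mathbf{u}},\mathbf{x}^*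 )\le0)\ge1-\epsilon$. A family $\{\mathcal{U}_\epsilon:0<\epsilon<1\}$ simultaneously implies a probabilistic guarantee for $\mathbb{P}^*$ if for every $0<\epsilon<1$ the set $\mathcal{U}_\epsilon$ implies one at level $\epsilon$.
   Formalization: In the definition of U^LCX_ε the threshold is multiplied by z: the right-hand side is (z/N)Σ(a^T û_j − b)^+ + zΓ_LCX instead of (z/N)Σ(a^T û_j − b)^+ + Γ_LCX; with the printed formula the claim is false (e.g. d=N=1, û_1=0, Γ_LCX=1, ε=1/2, v=1). *)

theory Defs
  imports "HOL-Probability.Probability"
begin

definition borel_prob :: "(real^'n) measure \<Rightarrow> bool" where
  "borel_prob P \<longleftrightarrow> prob_space P \<and> sets P = sets borel"

text \<open>The event is given through a measurable subset, so that \<open>Q\<close> itself need not be measurable;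
  for measurable \<open>Q\<close> this is the usual \<open>Prob(Q) \<ge> p\<close>.\<close>

definition with_prob_at_least :: "'w measure \<Rightarrow> real \<Rightarrow> ('w \<Rightarrow> bool) \<Rightarrow> bool" where
  "with_prob_at_least M p Q \<longleftrightarrow> (\<exists>E\<in>sets M. measure M E \<ge> p \<and> (\<forall>\<omega>\<in>E. Q \<omega>))"

definition sampling :: "nat \<Rightarrow> (real^'n) measure \<Rightarrow> (nat \<Rightarrow> real^'n) measure" where
  "sampling N P = (\<Pi>\<^sub>M j\<in>{..<N}. P)"

definition VaR :: "(real^'n) measure \<Rightarrow> real \<Rightarrow> real^'n \<Rightarrow> real" where
  "VaR P \<epsilon> v = Inf {t. measure P {u. u \<bullet> v \<le> t} \<ge> 1 - \<epsilon>}"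

definition support_fun :: "real^'n \<Rightarrow> (real^'n) set \<Rightarrow> ereal" where
  "support_fun v U = (SUP u\<in>U. ereal (v \<bullet> u))"

text \<open>The type argument fixes the dimension of the decision variable \<open>x\<close>.
  \<open>{u. f u x \<le> 0}\<close> is a Borel set because a finite concave function on \<open>\<real>\<^sup>d\<close> is continuous.\<close>

definition implies_guarantee ::
  "'k::finite itself \<Rightarrow> (real^'n) measure \<Rightarrow> real \<Rightarrow> (real^'n) set \<Rightarrow> bool" where
  "implies_guarantee _ P \<epsilon> U \<longleftrightarrow>
     (\<forall>(xstar :: real^'k) (f :: real^'n \<Rightarrow> real^'k \<Rightarrow> real).
        (\<forall>x. concave_on UNIV (\<lambda>u. f u x)) \<longrightarrow>
        (\<forall>u\<in>U. f u xstar \<le> 0) \<longrightarrow>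
        measure P {u. f u xstar \<le> 0} \<ge> 1 - \<epsilon>)"

definition simultaneously_implies_guarantee ::
  "'k::finite itself \<Rightarrow> (real^'n) measure \<Rightarrow> (real \<Rightarrow> (real^'n) set) \<Rightarrow> bool" where
  "simultaneously_implies_guarantee K P U \<longleftrightarrow>
     (\<forall>\<epsilon>. 0 < \<epsilon> \<and> \<epsilon> < 1 \<longrightarrow> implies_guarantee K P \<epsilon> (U \<epsilon>))"

definition pos_part :: "real \<Rightarrow> real" where
  "pos_part x = max x 0"

definition B_set :: "((real^'n) \<times> real) set" where
  "B_set = {(a, b). (\<Sum>i\<in>UNIV. \<bar>a $ i\<bar>) + \<bar>b\<bar> \<le> 1}"

definition Gamma_fn ::
  "nat \<Rightarrow> (nat \<Rightarrow> real^'n) \<Rightarrow> real \<Rightarrow> real^'n \<Rightarrow> real \<Rightarrow> real" where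
  "Gamma_fn N us \<Gamma>LCX a b = (1 / real N) * (\<Sum>j<N. pos_part (a \<bullet> us j - b)) + \<Gamma>LCX"

text \<open>The expectations are those of nonnegative functions with values in \<open>[0, \<infinity>]\<close>. In the second
  constraint \<open>ennreal\<close> truncates a negative bound to \<open>0\<close>, where the constraint is void.\<close>

definition P_LCX ::
  "nat \<Rightarrow> (nat \<Rightarrow> real^'n) \<Rightarrow> real \<Rightarrow> real \<Rightarrow> (real^'n) measure set" where
  "P_LCX N us \<Gamma>LCX \<Gamma>\<sigma> = {P. borel_prob P \<and>
     (\<forall>(a, b)\<in>B_set.
        (\<integral>\<^sup>+u. ennreal (pos_part (a \<bullet> u - b)) \<partial>P) \<le> ennreal (Gamma_fn N us \<Gamma>LCX a b)) \<and>
     (\<integral>\<^sup>+u. ennreal ((norm u)\<^sup>2) \<partial>P)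
       \<ge> ennreal ((1 / real N) * (\<Sum>j<N. (norm (us j))\<^sup>2) - \<Gamma>\<sigma>)}"

text \<open>The factor \<open>z\<close> multiplies all of \<open>\<Gamma>(a, b)\<close>, the threshold included: the right-hand side is
  \<open>(z/N) \<Sum>\<^sub>j (a \<bullet> us j - b)\<^sup>+ + z \<Gamma>LCX\<close>. This is what one gets by putting mass \<open>1/z \<ge> \<epsilon>\<close> at \<open>u\<close> and the
  remaining mass at \<open>r/(z - 1)\<close> and multiplying the constraint \<open>E (a \<bullet> u - b)\<^sup>+ \<le> \<Gamma>(a, b)\<close> by \<open>z\<close>, and
  it is what the term \<open>\<integral> \<Gamma> d\<lambda>\<close> of the dual program below corresponds to. With \<open>\<Gamma>LCX\<close> in place of
  \<open>z \<Gamma>LCX\<close> the set would be too small: for \<open>d = N = 1\<close>, \<open>us 0 = 0\<close>, \<open>\<epsilon> = 1/2\<close>, \<open>v = 1\<close> its support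
  function would be at most \<open>\<Gamma>LCX\<close>, while the supremum of the values at risk is \<open>2 \<Gamma>LCX\<close>.\<close>

definition U_LCX ::
  "nat \<Rightarrow> (nat \<Rightarrow> real^'n) \<Rightarrow> real \<Rightarrow> real \<Rightarrow> (real^'n) set" where
  "U_LCX N us \<Gamma>LCX \<epsilon> = {u. \<exists>(r :: real^'n) (z :: real). 1 \<le> z \<and> z \<le> 1 / \<epsilon> \<and>
     (\<forall>(a, b)\<in>B_set.
        pos_part (a \<bullet> r - b * (z - 1)) + pos_part (a \<bullet> u - b) \<le> z * Gamma_fn N us \<Gamma>LCX a b)}"

definition B_measure :: "((real^'n) \<times> real) measure \<Rightarrow> bool" where
  "B_measure m \<longleftrightarrow> sets m = sets (restrict_space borel B_set)"

text \<open>Finiteness of \<open>l\<close> (hence of \<open>y1\<close> and \<open>y2\<close>) is implicit in the constraint on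
  \<open>\<integral> \<Gamma> d\<lambda>\<close>, since \<open>\<Gamma> \<ge> \<Gamma>LCX > 0\<close>; it has to be explicit because the Bochner integral of a
  non-integrable function is \<open>0\<close>. All the integrands are bounded on \<open>B_set\<close>.\<close>

definition dual_feasible ::
  "nat \<Rightarrow> (nat \<Rightarrow> real^'n) \<Rightarrow> real \<Rightarrow> real^'n \<Rightarrow> real \<Rightarrow> real \<Rightarrow>
   ((real^'n) \<times> real) measure \<Rightarrow> ((real^'n) \<times> real) measure \<Rightarrow> ((real^'n) \<times> real) measure \<Rightarrow> bool" where
  "dual_feasible N us \<Gamma>LCX v \<tau> \<theta> y1 y2 l \<longleftrightarrow>
     B_measure y1 \<and> B_measure y2 \<and> B_measure l \<and> finite_measure l \<and>
     \<theta> + (\<integral>(a, b). b \<partial>y1) + (\<integral>(a, b). Gamma_fn N us \<Gamma>LCX a b \<partial>l) \<le> \<tau> \<and>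
     (\<forall>A\<in>sets (restrict_space borel B_set). emeasure y1 A \<le> emeasure l A) \<and>
     (\<forall>A\<in>sets (restrict_space borel B_set). emeasure y2 A \<le> emeasure l A) \<and>
     (\<integral>(a, b). a \<partial>y1) = 0 \<and> v = (\<integral>(a, b). a \<partial>y2) \<and> \<theta> \<ge> 0 \<and> \<tau> \<ge> 0"

definition dual_objective ::
  "real \<Rightarrow> real \<Rightarrow> real \<Rightarrow> ((real^'n) \<times> real) measure \<Rightarrow> ((real^'n) \<times> real) measure \<Rightarrow> real" where
  "dual_objective \<epsilon> \<tau> \<theta> y1 y2 = (1 / \<epsilon>) * \<tau> - \<theta> - (\<integral>(a, b). b \<partial>y1) + (\<integral>(a, b). b \<partial>y2)"

definition dual_values ::
  "nat \<Rightarrow> (nat \<Rightarrow> real^'n) \<Rightarrow> real \<Rightarrow> real \<Rightarrow> real^'n \<Rightarrow> real set" where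
  "dual_values N us \<Gamma>LCX \<epsilon> v =
     {dual_objective \<epsilon> \<tau> \<theta> y1 y2 | \<tau> \<theta> y1 y2 l. dual_feasible N us \<Gamma>LCX v \<tau> \<theta> y1 y2 l}"

definition is_minimum :: "real set \<Rightarrow> real \<Rightarrow> bool" where
  "is_minimum S m \<longleftrightarrow> m \<in> S \<and> (\<forall>s\<in>S. m \<le> s)"

end

theory Submission
  imports Defs
begin

text \<open>The constraints of \<open>U_LCX\<close> describe a two-block splitting of a distribution. If \<open>P\<close> is in the
  confidence region and \<open>H\<close> is an event of mass \<open>p \<ge> \<epsilon>\<close>, replace \<open>P\<close> by its conditional means on
  \<open>H\<close> and on the complement of \<open>H\<close>. By Jensen's inequality this only decreases \<open>E (a \<bullet> u - b)\<^sup>+\<close>,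
  and with \<open>z = 1 / p\<close> the inequality that remains is the membership condition for the mean on \<open>H\<close>
  (\<open>barycenter_in_U_LCX\<close>). Two choices of \<open>H\<close> give two of the claims: if a concave \<open>f\<close> were
  positive with probability more than \<open>\<epsilon>\<close>, the mean over the open convex set \<open>{f > 0}\<close> would be a
  point of \<open>U_LCX\<close> inside that set, which contradicts robust feasibility (\<open>implies_guarantee_U_LCX\<close>);
  and if \<open>P\<close> puts mass more than \<open>\<epsilon>\<close> on a halfspace \<open>{v \<bullet> u > s}\<close>, then some point of \<open>U_LCX\<close>
  lies in that halfspace, so the value at risk is at most the support function
  (\<open>VaR_le_support_fun\<close>).

  Conversely, a point \<open>u\<close> of \<open>U_LCX\<close> with witnesses \<open>r\<close>, \<open>z\<close> yields the distribution with mass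
  \<open>1 / z\<close> at \<open>u\<close> and the rest at \<open>r / (z - 1)\<close>. Two obstacles remain. If the mass at \<open>u\<close> is exactly
  \<open>\<epsilon>\<close>, the value at risk can ignore it; and the second-moment constraint may fail. Both disappear after
  moving \<open>u\<close> slightly towards the sample mean, which satisfies the constraints with slack because of
  \<open>\<Gamma>LCX > 0\<close>: the mass at \<open>u\<close> then exceeds \<open>\<epsilon>\<close>, and the slack pays for a tiny mass so far away that
  the second moment is as large as required. So the supremum of the values at risk is not attained in
  general, but it equals the support function (\<open>support_fun_le_SUP_VaR\<close>).

  For the dual program, maximizing \<open>v \<bullet> u\<close> over \<open>(u, r, z)\<close> is a linear program in finitely many
  variables, whose constraints are indexed by the compact set \<open>B_set\<close> and by the four ways of dropping
  or keeping each positive part. It has a Slater point, again the sample mean. Compactness and the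
  Slater point make the cone of valid inequalities closed, so the separation theorem gives optimal
  multipliers, finitely many of them nonzero (\<open>semi_infinite_farkas\<close>). Read as finitely supported
  measures on \<open>B_set\<close>, they attain the minimum (\<open>dual_attained\<close>); weak duality is integration of the
  constraints (\<open>weak_duality\<close>).\<close>

section \<open>Positive parts and the index set\<close>

lemma pos_part_nonneg [simp]: "0 \<le> pos_part x" and pos_part_ge: "x \<le> pos_part x"
  by (simp_all add: pos_part_def)

lemma pos_part_mult: "0 \<le> c \<Longrightarrow> pos_part (c * x) = c * pos_part x"
  by (simp add: pos_part_def max_def zero_le_mult_iff mult_le_0_iff)

lemma pos_part_add_le: "pos_part (x + y) \<le> pos_part x + pos_part y"
  by (simp add: pos_part_def)

lemma pos_part_sum_le: "pos_part (\<Sum>i\<in>I. f i) \<le> (\<Sum>i\<in>I. pos_part (f i))"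
proof (induction I rule: infinite_finite_induct)
  case (insert i I)
  then show ?case using pos_part_add_le[of "f i" "sum f I"] by simp
qed (simp_all add: pos_part_def)

lemma pos_part_eq_of_bool: "pos_part x = of_bool (0 \<le> x) * x"
  by (simp add: pos_part_def)

lemma of_bool_mult_le_pos_part: "of_bool k * x \<le> pos_part x"
  by (simp add: pos_part_def)

lemma continuous_on_pos_part [continuous_intros]:
  "continuous_on A f \<Longrightarrow> continuous_on A (\<lambda>x. pos_part (f x))"
  unfolding pos_part_def by (intro continuous_intros)

lemma borel_measurable_pos_part [measurable]: "pos_part \<in> borel_measurable borel"
  unfolding pos_part_def by measurable

lemma compact_B_set: "compact (B_set :: ((real^'n) \<times> real) set)"
proof -
  have "closed (B_set :: ((real^'n) \<times> real) set)"
    unfolding B_set_def case_prod_unfold by (intro closed_Collect_le continuous_intros)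
  moreover have "(B_set :: ((real^'n) \<times> real) set) \<subseteq> cball 0 1 \<times> cball 0 1"
  proof (clarsimp simp: B_set_def)
    fix a :: "real^'n" and b :: real
    assume "(\<Sum>i\<in>UNIV. \<bar>a $ i\<bar>) + \<bar>b\<bar> \<le> 1"
    then show "norm a \<le> 1 \<and> \<bar>b\<bar> \<le> 1"
      using norm_le_l1_cart[of a] norm_ge_zero[of a] by linarith
  qed
  ultimately show ?thesis
    by (metis bounded_subset bounded_Times bounded_cball compact_eq_bounded_closed)
qed

lemma B_set_bounds:
  assumes "(a, b) \<in> B_set"
  shows "norm a \<le> 1" "\<bar>b\<bar> \<le> 1"
proof -
  have "(\<Sum>i\<in>UNIV. \<bar>a $ i\<bar>) + \<bar>b\<bar> \<le> 1" using assms by (simp add: B_set_def)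
  then show "norm a \<le> 1" "\<bar>b\<bar> \<le> 1"
    using norm_le_l1_cart[of a] norm_ge_zero[of a] by linarith+
qed

lemma continuous_on_Gamma_fn:
  "continuous_on A (\<lambda>p. Gamma_fn N us \<Gamma>LCX (fst p) (snd p))"
  unfolding Gamma_fn_def by (intro continuous_intros)

lemma Gamma_fn_ge: "\<Gamma>LCX \<le> Gamma_fn N us \<Gamma>LCX a b"
  by (simp add: Gamma_fn_def sum_nonneg)

section \<open>The uncertainty set\<close>

lemma mem_U_LCX_iff:
  "u \<in> U_LCX N us \<Gamma>LCX \<epsilon> \<longleftrightarrow> (\<exists>r z. 1 \<le> z \<and> z \<le> 1 / \<epsilon> \<and>
     (\<forall>a b. (a, b) \<in> B_set \<longrightarrow>
        pos_part (a \<bullet> r - b * (z - 1)) + pos_part (a \<bullet> u - b) \<le> z * Gamma_fn N us \<Gamma>LCX a b))"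
  by (simp add: U_LCX_def Ball_def)

definition sample_mean :: "nat \<Rightarrow> (nat \<Rightarrow> real^'n) \<Rightarrow> real^'n" where
  "sample_mean N us = (1 / real N) *\<^sub>R (\<Sum>j<N. us j)"

text \<open>By Jensen's inequality the point mass at the sample mean satisfies every first-order constraint
  with the slack \<open>\<Gamma>LCX\<close>. This is the strict feasibility behind both the approximation of points of \<open>U_LCX\<close> by
  values at risk and the strong duality.\<close>

lemma pos_part_sample_mean_le:
  assumes "N \<ge> 1"
  shows "pos_part (a \<bullet> sample_mean N us - b) \<le> Gamma_fn N us \<Gamma>LCX a b - \<Gamma>LCX"
proof -
  have "a \<bullet> sample_mean N us - b = (1 / real N) * (\<Sum>j<N. a \<bullet> us j - b)"
    using assms by (simp add: sample_mean_def inner_sum_right sum_subtractf field_simps)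
  then have "pos_part (a \<bullet> sample_mean N us - b) = (1 / real N) * pos_part (\<Sum>j<N. a \<bullet> us j - b)"
    by (simp only: pos_part_mult zero_le_divide_1_iff of_nat_0_le_iff)
  also have "\<dots> \<le> (1 / real N) * (\<Sum>j<N. pos_part (a \<bullet> us j - b))"
    by (intro mult_left_mono pos_part_sum_le) simp
  finally show ?thesis by (simp add: Gamma_fn_def)
qed

lemma sample_mean_in_U_LCX:
  fixes us :: "nat \<Rightarrow> real^'n"
  assumes "N \<ge> 1" "\<Gamma>LCX > 0" "0 < \<epsilon>" "\<epsilon> < 1"
  shows "sample_mean N us \<in> U_LCX N us \<Gamma>LCX \<epsilon>"
  unfolding mem_U_LCX_iff
proof (intro exI conjI allI impI)
  show "(1::real) \<le> 1" "1 \<le> 1 / \<epsilon>" using assms by auto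
  fix a :: "real^'n" and b :: real
  show "pos_part (a \<bullet> 0 - b * (1 - 1)) + pos_part (a \<bullet> sample_mean N us - b)
      \<le> 1 * Gamma_fn N us \<Gamma>LCX a b"
    using pos_part_sample_mean_le[OF assms(1), of a us b \<Gamma>LCX] assms(2) by (simp add: pos_part_def[of 0])
qed

text \<open>The constraint at \<open>b = 0\<close> and \<open>a\<close> the normalization of \<open>v\<close> in the 1-norm already bounds
  \<open>v \<bullet> u\<close>, so the support function is finite.\<close>

lemma U_LCX_inner_le:
  fixes us :: "nat \<Rightarrow> real^'n"
  assumes "0 < \<epsilon>" "\<Gamma>LCX > 0"
  obtains K where "\<And>u. u \<in> U_LCX N us \<Gamma>LCX \<epsilon> \<Longrightarrow> v \<bullet> u \<le> K"
proof -
  define L where "L = (\<Sum>i\<in>UNIV. \<bar>v $ i\<bar>)"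
  define a where "a = inverse L *\<^sub>R v"
  have "0 \<le> L" by (simp add: L_def sum_nonneg)
  have v: "v = L *\<^sub>R a"
  proof (cases "L = 0")
    case True
    then have "v = 0" by (simp add: L_def sum_nonneg_eq_0_iff vec_eq_iff)
    then show ?thesis by (simp add: a_def)
  qed (simp add: a_def)
  have "(\<Sum>i\<in>UNIV. \<bar>a $ i\<bar>) = inverse L * L"
    using \<open>0 \<le> L\<close> by (simp add: a_def abs_mult L_def sum_distrib_left)
  then have aB: "(a, 0) \<in> B_set"
    by (cases "L = 0") (auto simp: B_set_def)
  have "v \<bullet> u \<le> L * (1 / \<epsilon> * Gamma_fn N us \<Gamma>LCX a 0)" if u: "u \<in> U_LCX N us \<Gamma>LCX \<epsilon>" for u
  proof -
    obtain r z where z: "1 \<le> z" "z \<le> 1 / \<epsilon>"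
      and "pos_part (a \<bullet> r - 0 * (z - 1)) + pos_part (a \<bullet> u - 0) \<le> z * Gamma_fn N us \<Gamma>LCX a 0"
      using u aB unfolding mem_U_LCX_iff by blast
    then have "a \<bullet> u \<le> z * Gamma_fn N us \<Gamma>LCX a 0"
      using pos_part_ge[of "a \<bullet> u"] pos_part_nonneg[of "a \<bullet> r"] by (simp del: pos_part_nonneg)
    also have "\<dots> \<le> 1 / \<epsilon> * Gamma_fn N us \<Gamma>LCX a 0"
      using z Gamma_fn_ge[of \<Gamma>LCX N us a 0] assms by (intro mult_right_mono) auto
    finally have "L * (a \<bullet> u) \<le> L * (1 / \<epsilon> * Gamma_fn N us \<Gamma>LCX a 0)"
      using \<open>0 \<le> L\<close> by (rule mult_left_mono)
    then show ?thesis by (subst v) simp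
  qed
  then show thesis by (rule that)
qed

section \<open>Moments of distributions in the confidence region\<close>

lemma P_LCX_prob_space: "P \<in> P_LCX N us \<Gamma>LCX \<Gamma>\<sigma> \<Longrightarrow> prob_space P"
  and P_LCX_sets: "P \<in> P_LCX N us \<Gamma>LCX \<Gamma>\<sigma> \<Longrightarrow> sets P = sets borel"
  by (simp_all add: P_LCX_def borel_prob_def)

lemma P_LCX_pos_part:
  assumes P: "P \<in> P_LCX N us \<Gamma>LCX \<Gamma>\<sigma>" and "0 \<le> \<Gamma>LCX" and ab: "(a, b) \<in> B_set"
  shows "integrable P (\<lambda>u. pos_part (a \<bullet> u - b))"
    and "(\<integral>u. pos_part (a \<bullet> u - b) \<partial>P) \<le> Gamma_fn N us \<Gamma>LCX a b"
proof -
  have [measurable_cong]: "sets P = sets borel" using P by (rule P_LCX_sets)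
  have nn: "(\<integral>\<^sup>+u. ennreal (pos_part (a \<bullet> u - b)) \<partial>P) \<le> ennreal (Gamma_fn N us \<Gamma>LCX a b)"
    using P ab unfolding P_LCX_def by blast
  then have fin: "(\<integral>\<^sup>+u. ennreal (pos_part (a \<bullet> u - b)) \<partial>P) < \<infinity>"
    using ennreal_less_top infinity_ennreal_def order_le_less_trans by metis
  show int: "integrable P (\<lambda>u. pos_part (a \<bullet> u - b))"
    using fin by (intro integrableI_nonneg) auto
  have "0 \<le> Gamma_fn N us \<Gamma>LCX a b" using Gamma_fn_ge \<open>0 \<le> \<Gamma>LCX\<close> by (rule order_trans[rotated])
  then show "(\<integral>u. pos_part (a \<bullet> u - b) \<partial>P) \<le> Gamma_fn N us \<Gamma>LCX a b"
    using nn nn_integral_eq_integral[OF int] by (simp add: ennreal_le_iff)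
qed

text \<open>The constraints at \<open>b = 0\<close> and \<open>a\<close> plus or minus a coordinate vector bound the first absolute
  moments, so conditional means exist.\<close>

lemma P_LCX_integrable:
  fixes P :: "(real^'n) measure"
  assumes P: "P \<in> P_LCX N us \<Gamma>LCX \<Gamma>\<sigma>" and "0 \<le> \<Gamma>LCX"
  shows "integrable P (\<lambda>u. u)"
proof (rule Bochner_Integration.integrable_bound)
  have [measurable_cong]: "sets P = sets borel" using P by (rule P_LCX_sets)
  let ?g = "\<lambda>u. \<Sum>i\<in>UNIV. pos_part (axis i 1 \<bullet> u - 0) + pos_part (axis i (-1) \<bullet> u - 0)"
  have "(axis i c, 0) \<in> B_set" if "\<bar>c\<bar> = 1" for i :: 'n and c
  proof -
    have "(\<Sum>j\<in>UNIV. \<bar>axis i c $ j\<bar>) = (\<Sum>j\<in>UNIV. if j = i then \<bar>c\<bar> else 0)"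
      by (intro sum.cong) (auto simp: axis_def)
    then show ?thesis using that by (simp add: B_set_def)
  qed
  then show "integrable P ?g"
    by (intro Bochner_Integration.integrable_sum Bochner_Integration.integrable_add
        P_LCX_pos_part(1)[OF assms]) auto
  show "(\<lambda>u. u) \<in> borel_measurable P" by simp
  have "norm u \<le> ?g u" for u :: "real^'n"
  proof -
    have "pos_part (axis i 1 \<bullet> u - 0) + pos_part (axis i (-1) \<bullet> u - 0) = \<bar>u $ i\<bar>" for i
      by (simp add: inner_axis' pos_part_def)
    then show ?thesis using norm_le_l1_cart[of u] by simp
  qed
  then show "AE u in P. norm u \<le> norm (?g u)"
    by (intro AE_I2) (simp add: sum_nonneg)
qed

section \<open>Conditional means and the probabilistic guarantee\<close>

text \<open>For an event of positive mass this is the conditional mean; for a null event it is 0.\<close>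

definition barycenter :: "'a::euclidean_space measure \<Rightarrow> 'a set \<Rightarrow> 'a" where
  "barycenter P H = (1 / measure P H) *\<^sub>R (LINT u:H|P. u)"

lemma inner_set_integral_minus_const:
  fixes P :: "'a::euclidean_space measure"
  assumes "prob_space P" "sets P = sets borel" "integrable P (\<lambda>u. u)" "A \<in> sets borel"
  shows "set_integrable P A (\<lambda>u. a \<bullet> u - b)"
    and "(LINT u:A|P. a \<bullet> u - b) = a \<bullet> (LINT u:A|P. u) - b * measure P A"
proof -
  interpret prob_space P by fact
  have A: "A \<in> sets P" using assms by simp
  have 1: "integrable P (\<lambda>u. indicator A u *\<^sub>R u)"
    using A assms(3) by (rule integrable_mult_indicator)
  have 2: "integrable P (\<lambda>u. indicator A u *\<^sub>R b)"
    using A by (intro integrable_mult_indicator) auto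
  have eq: "(\<lambda>u. indicator A u *\<^sub>R (a \<bullet> u - b)) =
      (\<lambda>u. a \<bullet> (indicator A u *\<^sub>R u) - indicator A u *\<^sub>R b)"
    by (auto simp: algebra_simps)
  have 3: "integrable P (\<lambda>u. a \<bullet> (indicator A u *\<^sub>R u))" using 1 by (intro integrable_inner_right)
  show "set_integrable P A (\<lambda>u. a \<bullet> u - b)"
    unfolding set_integrable_def eq using 3 2 by (rule Bochner_Integration.integrable_diff)
  have "(\<integral>u. indicator A u *\<^sub>R b \<partial>P) = measure P A * b" using A by simp
  then show "(LINT u:A|P. a \<bullet> u - b) = a \<bullet> (LINT u:A|P. u) - b * measure P A"
    unfolding set_lebesgue_integral_def eq
    using Bochner_Integration.integral_diff[OF 3 2] integral_inner_right[OF 1, of a] by simp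
qed

lemma pos_part_set_integral_le:
  assumes "set_integrable M A f" "set_integrable M A (\<lambda>x. pos_part (f x))"
  shows "pos_part (LINT x:A|M. f x) \<le> (LINT x:A|M. pos_part (f x))"
proof -
  have "(LINT x:A|M. f x) \<le> (LINT x:A|M. pos_part (f x))"
    using assms by (intro set_integral_mono pos_part_ge)
  moreover have "0 \<le> (LINT x:A|M. pos_part (f x))"
    unfolding set_lebesgue_integral_def by (intro integral_nonneg_AE) simp
  ultimately show ?thesis by (simp add: pos_part_def)
qed

text \<open>The witnesses are \<open>z = 1 / p\<close>, where \<open>p\<close> is the mass of \<open>H\<close>, and for \<open>r\<close> the mean of the
  complement, scaled by \<open>z - 1\<close>; the scaling makes the formula meaningful for \<open>p = 1\<close> too. Jensen's
  inequality on \<open>H\<close> and on its complement bounds the two positive parts by the two parts of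
  \<open>z * E (a \<bullet> u - b)\<^sup>+\<close>.\<close>

lemma barycenter_in_U_LCX:
  fixes P :: "(real^'n) measure"
  assumes P: "P \<in> P_LCX N us \<Gamma>LCX \<Gamma>\<sigma>" and "0 \<le> \<Gamma>LCX" and "0 < \<epsilon>"
    and H: "H \<in> sets borel" and mass: "\<epsilon> \<le> measure P H"
  shows "barycenter P H \<in> U_LCX N us \<Gamma>LCX \<epsilon>"
proof -
  interpret prob_space P using P by (rule P_LCX_prob_space)
  have setsP: "sets P = sets borel" using P by (rule P_LCX_sets)
  have int: "integrable P (\<lambda>u. u)" using P \<open>0 \<le> \<Gamma>LCX\<close> by (rule P_LCX_integrable)
  have H': "- H \<in> sets borel" using H by auto
  note lin = inner_set_integral_minus_const[OF prob_space_axioms setsP int]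
  define p where "p = measure P H"
  have p: "0 < p" "\<epsilon> \<le> p" "p \<le> 1" using assms(3) mass by (auto simp: p_def)
  have compl: "measure P (- H) = 1 - p"
    using prob_compl[of H] H setsP sets_eq_imp_space_eq[OF setsP] by (simp add: p_def Compl_eq_Diff_UNIV)
  define r where "r = (1 / p) *\<^sub>R (LINT u:-H|P. u)"
  show ?thesis
    unfolding mem_U_LCX_iff
  proof (intro exI[of _ r] exI[of _ "1 / p"] conjI allI impI)
    show "1 \<le> 1 / p" "1 / p \<le> 1 / \<epsilon>"
      using p \<open>0 < \<epsilon>\<close> by (auto simp: field_simps)
    fix a :: "real^'n" and b :: real
    assume ab: "(a, b) \<in> B_set"
    let ?f = "\<lambda>u. pos_part (a \<bullet> u - b)"
    note f = P_LCX_pos_part[OF P \<open>0 \<le> \<Gamma>LCX\<close> ab]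
    have f_set: "set_integrable P A ?f" if "A \<in> sets borel" for A
      unfolding set_integrable_def using that setsP f(1) by (intro integrable_mult_indicator) auto
    have "a \<bullet> r - b * (1 / p - 1) = (1 / p) * (LINT u:-H|P. a \<bullet> u - b)"
      using p by (simp add: lin(2)[OF H'] compl r_def field_simps)
    then have 1: "pos_part (a \<bullet> r - b * (1 / p - 1)) \<le> (1 / p) * (LINT u:-H|P. ?f u)"
      using p pos_part_set_integral_le[OF lin(1)[OF H'] f_set[OF H']]
      by (simp only: pos_part_mult zero_le_divide_1_iff less_imp_le mult_left_mono)
    have "a \<bullet> barycenter P H - b = (1 / p) * (LINT u:H|P. a \<bullet> u - b)"
      using p by (simp add: lin(2)[OF H] barycenter_def p_def[symmetric] field_simps)
    then have 2: "pos_part (a \<bullet> barycenter P H - b) \<le> (1 / p) * (LINT u:H|P. ?f u)"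
      using p pos_part_set_integral_le[OF lin(1)[OF H] f_set[OF H]]
      by (simp only: pos_part_mult zero_le_divide_1_iff less_imp_le mult_left_mono)
    have "(LINT u:-H|P. ?f u) + (LINT u:H|P. ?f u) = (LINT u:- H \<union> H|P. ?f u)"
      using f_set H H' by (intro set_integral_Un[symmetric]) auto
    also have "\<dots> = (\<integral>u. ?f u \<partial>P)" by (simp add: set_lebesgue_integral_def)
    also have "\<dots> \<le> Gamma_fn N us \<Gamma>LCX a b" by (rule f(2))
    finally have "(1 / p) * ((LINT u:-H|P. ?f u) + (LINT u:H|P. ?f u)) \<le> (1 / p) * Gamma_fn N us \<Gamma>LCX a b"
      using p by (intro mult_left_mono) auto
    with 1 2 show "pos_part (a \<bullet> r - b * (1 / p - 1)) + pos_part (a \<bullet> barycenter P H - b)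
        \<le> 1 / p * Gamma_fn N us \<Gamma>LCX a b"
      by (simp only: distrib_left)
  qed
qed

lemma barycenter_in_open_halfspace:
  fixes P :: "'a::euclidean_space measure"
  assumes "prob_space P" "sets P = sets borel" "integrable P (\<lambda>u. u)" "H \<in> sets borel"
    and "0 < measure P H" and sub: "\<And>u. u \<in> H \<Longrightarrow> c < g \<bullet> u"
  shows "c < g \<bullet> barycenter P H"
proof -
  interpret prob_space P by fact
  note lin = inner_set_integral_minus_const[OF assms(1-4), of g c]
  have "(\<integral>u. 0 \<partial>P) < (\<integral>u. indicator H u *\<^sub>R (g \<bullet> u - c) \<partial>P)"
  proof (rule integral_less_AE[where A = H])
    show "integrable P (\<lambda>u. indicator H u *\<^sub>R (g \<bullet> u - c))"
      using lin(1) by (simp add: set_integrable_def)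
    show "emeasure P H \<noteq> 0" using assms(5) by (auto simp: measure_def)
    show "AE u in P. u \<in> H \<longrightarrow> 0 \<noteq> indicator H u *\<^sub>R (g \<bullet> u - c)"
      using sub by (intro AE_I2) force
    show "AE u in P. 0 \<le> indicator H u *\<^sub>R (g \<bullet> u - c)"
      using sub by (intro AE_I2) (auto simp: indicator_def less_imp_le)
  qed (use assms in auto)
  then have "0 < g \<bullet> (LINT u:H|P. u) - c * measure P H"
    using lin(2) by (simp add: set_lebesgue_integral_def)
  then show ?thesis using assms(5) by (simp add: barycenter_def field_simps)
qed

text \<open>Otherwise a hyperplane separates the mean from \<open>H\<close>. As \<open>H\<close> is open, it lies strictly on one side,
  and then so does the mean.\<close>

lemma barycenter_in_open_convex:
  fixes P :: "'a::euclidean_space measure"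
  assumes "prob_space P" "sets P = sets borel" "integrable P (\<lambda>u. u)"
    and "open H" "convex H" "0 < measure P H"
  shows "barycenter P H \<in> H"
proof (rule ccontr)
  assume "barycenter P H \<notin> H"
  moreover have "H \<noteq> {}" using assms(6) by auto
  ultimately obtain g c where "g \<noteq> 0" "\<forall>x\<in>{barycenter P H}. g \<bullet> x \<le> c" "\<forall>x\<in>H. c \<le> g \<bullet> x"
    using separating_hyperplane_sets[of "{barycenter P H}" H] assms(5) by auto
  moreover from this have "H \<subseteq> interior {x. c \<le> g \<bullet> x}"
    using \<open>open H\<close> by (intro interior_maximal) auto
  ultimately show False
    using barycenter_in_open_halfspace[OF assms(1-3) _ assms(6), of c g] \<open>open H\<close>
    by (force simp: interior_halfspace_ge)
qed

text \<open>Apply the preceding results to the violation event \<open>{f > 0}\<close>: it is convex because \<open>f\<close> is concave,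
  and open because a finite concave function is continuous.\<close>

lemma implies_guarantee_U_LCX:
  fixes P :: "(real^'n) measure"
  assumes P: "P \<in> P_LCX N us \<Gamma>LCX \<Gamma>\<sigma>" and "0 \<le> \<Gamma>LCX" and "0 < \<epsilon>"
  shows "implies_guarantee TYPE('k::finite) P \<epsilon> (U_LCX N us \<Gamma>LCX \<epsilon>)"
  unfolding implies_guarantee_def
proof (intro allI impI)
  interpret prob_space P using P by (rule P_LCX_prob_space)
  have setsP: "sets P = sets borel" using P by (rule P_LCX_sets)
  fix x :: "real^'k" and f :: "real^'n \<Rightarrow> real^'k \<Rightarrow> real"
  assume concave: "\<forall>x. concave_on UNIV (\<lambda>u. f u x)"
    and robust: "\<forall>u\<in>U_LCX N us \<Gamma>LCX \<epsilon>. f u x \<le> 0"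
  define H where "H = {u. 0 < f u x}"
  have conv: "convex_on UNIV (\<lambda>u. - f u x)" using concave by (simp add: concave_on_def)
  then have "continuous_on UNIV (\<lambda>u. - f u x)" by (intro convex_on_continuous) auto
  then have "continuous_on UNIV (\<lambda>u. f u x)" using continuous_on_minus by fastforce
  then have "open H" unfolding H_def by (intro open_Collect_less continuous_intros)
  have "convex H"
  proof (rule convexI)
    fix u w and s t :: real
    assume "u \<in> H" "w \<in> H" "0 \<le> s" "0 \<le> t" "s + t = 1"
    then show "s *\<^sub>R u + t *\<^sub>R w \<in> H"
      using convex_lower[OF conv, of u w s t] by (auto simp: H_def max_def split: if_splits)
  qed
  show "1 - \<epsilon> \<le> measure P {u. f u x \<le> 0}"
  proof (rule ccontr)
    assume "\<not> 1 - \<epsilon> \<le> measure P {u. f u x \<le> 0}"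
    moreover have "{u. f u x \<le> 0} = space P - H"
      using sets_eq_imp_space_eq[OF setsP] by (auto simp: H_def)
    ultimately have mass: "\<epsilon> < measure P H"
      using prob_compl[of H] \<open>open H\<close> setsP by simp
    have "barycenter P H \<in> H"
      using mass \<open>0 < \<epsilon>\<close> \<open>open H\<close> \<open>convex H\<close> P_LCX_integrable[OF P \<open>0 \<le> \<Gamma>LCX\<close>]
      by (intro barycenter_in_open_convex prob_space_axioms setsP) auto
    moreover have "barycenter P H \<in> U_LCX N us \<Gamma>LCX \<epsilon>"
      using mass \<open>open H\<close> by (intro barycenter_in_U_LCX[OF assms]) auto
    ultimately show False using robust by (force simp: H_def)
  qed
qed

section \<open>Finitely supported measures\<close>

text \<open>The index set \<open>I\<close> is kept separate from the atoms, so that several indices may share an atom and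
  several measures with different weights may share the atoms.\<close>

definition atomic :: "'i set \<Rightarrow> ('i \<Rightarrow> real) \<Rightarrow> 'a measure \<Rightarrow> ('i \<Rightarrow> 'a) \<Rightarrow> 'a measure" where
  "atomic I w M x = distr (point_measure I (\<lambda>i. ennreal (w i))) M x"

lemma sets_atomic [simp]: "sets (atomic I w M x) = sets M"
  by (simp add: atomic_def)

lemma space_atomic [simp]: "space (atomic I w M x) = space M"
  by (simp add: atomic_def)

lemma nn_integral_atomic:
  assumes "finite I" "x ` I \<subseteq> space M" "f \<in> borel_measurable M"
  shows "(\<integral>\<^sup>+y. f y \<partial>atomic I w M x) = (\<Sum>i\<in>I. ennreal (w i) * f (x i))"
  using assms
  by (simp add: atomic_def nn_integral_distr nn_integral_point_measure_finite mult.commute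
      measurable_def space_point_measure sets_point_measure image_subset_iff)

lemma emeasure_atomic:
  assumes "finite I" "x ` I \<subseteq> space M" "A \<in> sets M"
  shows "emeasure (atomic I w M x) A = (\<Sum>i\<in>I. ennreal (w i) * indicator A (x i))"
  using nn_integral_atomic[OF assms(1,2), of "indicator A" w] assms(3) by simp

lemma integral_atomic:
  fixes f :: "'a \<Rightarrow> 'b::{banach, second_countable_topology}"
  assumes "finite I" "x ` I \<subseteq> space M" "f \<in> borel_measurable M" "\<And>i. i \<in> I \<Longrightarrow> 0 \<le> w i"
  shows "(\<integral>y. f y \<partial>atomic I w M x) = (\<Sum>i\<in>I. w i *\<^sub>R f (x i))"
  using assms
  by (simp add: atomic_def integral_distr lebesgue_integral_point_measure_finite
      measurable_def space_point_measure sets_point_measure image_subset_iff)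

section \<open>Values at risk\<close>

text \<open>The infimum that defines the value at risk is the infimum of a nonempty set that is bounded below,
  since a distribution function tends to 0 and to 1 at the two ends.\<close>

lemma VaR_set:
  fixes P :: "(real^'n) measure"
  assumes P: "prob_space P" "sets P = sets borel" and "0 < \<epsilon>" "\<epsilon> < 1"
  shows "{t. measure P {u. u \<bullet> v \<le> t} \<ge> 1 - \<epsilon>} \<noteq> {}"
    and "bdd_below {t. measure P {u. u \<bullet> v \<le> t} \<ge> 1 - \<epsilon>}"
proof -
  interpret prob_space P by fact
  define D where "D = distr P borel (\<lambda>u. u \<bullet> v)"
  have m: "(\<lambda>u. u \<bullet> v) \<in> borel_measurable P" using P by (simp cong: measurable_cong_sets)
  interpret D: real_distribution D unfolding D_def using m by (rule real_distribution_distr)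
  have cdf: "measure P {u. u \<bullet> v \<le> t} = cdf D t" for t
    using sets_eq_imp_space_eq[OF P(2)] m
    by (simp add: cdf_def D_def measure_distr vimage_def)
  have "eventually (\<lambda>t. 1 - \<epsilon> < cdf D t) at_top"
    using order_tendstoD(1)[OF D.cdf_lim_at_top_prob, of "1 - \<epsilon>"] \<open>0 < \<epsilon>\<close> by simp
  then obtain t where "1 - \<epsilon> < cdf D t"
    by (metis eventually_happens trivial_limit_at_top_linorder)
  then show "{t. measure P {u. u \<bullet> v \<le> t} \<ge> 1 - \<epsilon>} \<noteq> {}"
    unfolding cdf by (force intro: less_imp_le)
  have "eventually (\<lambda>t. cdf D t < 1 - \<epsilon>) at_bot"
    using order_tendstoD(2)[OF D.cdf_lim_at_bot, of "1 - \<epsilon>"] \<open>\<epsilon> < 1\<close> by simp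
  then obtain t0 where "\<And>t. t \<le> t0 \<Longrightarrow> cdf D t < 1 - \<epsilon>"
    by (auto simp: eventually_at_bot_linorder)
  then have "t0 \<le> t" if "1 - \<epsilon> \<le> cdf D t" for t
    using that by (metis linorder_le_cases linorder_not_less)
  then show "bdd_below {t. measure P {u. u \<bullet> v \<le> t} \<ge> 1 - \<epsilon>}"
    unfolding cdf by (intro bdd_belowI) auto
qed

text \<open>The mass must exceed \<open>\<epsilon>\<close> strictly: with mass exactly \<open>\<epsilon>\<close> the condition
  \<open>P (u \<bullet> v \<le> s) \<ge> 1 - \<epsilon>\<close> can already hold for some \<open>s < t\<close>.\<close>

lemma VaR_ge:
  fixes P :: "(real^'n) measure"
  assumes P: "prob_space P" "sets P = sets borel" and "0 < \<epsilon>" "\<epsilon> < 1"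
    and mass: "\<epsilon> < measure P {u. t \<le> u \<bullet> v}"
  shows "t \<le> VaR P \<epsilon> v"
  unfolding VaR_def
proof (rule cInf_greatest)
  interpret prob_space P by fact
  show "{t. measure P {u. u \<bullet> v \<le> t} \<ge> 1 - \<epsilon>} \<noteq> {}" using assms by (intro VaR_set)
  fix s assume "s \<in> {t. measure P {u. u \<bullet> v \<le> t} \<ge> 1 - \<epsilon>}"
  then have s: "1 - \<epsilon> \<le> measure P {u. u \<bullet> v \<le> s}" by simp
  show "t \<le> s"
  proof (rule ccontr)
    assume "\<not> t \<le> s"
    then have "{u. u \<bullet> v \<le> s} \<subseteq> space P - {u. t \<le> u \<bullet> v}"
      using sets_eq_imp_space_eq[OF P(2)] by auto
    moreover have "{u. t \<le> u \<bullet> v} \<in> sets P" unfolding P(2) by measurable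
    ultimately have "measure P {u. u \<bullet> v \<le> s} \<le> 1 - measure P {u. t \<le> u \<bullet> v}"
      using prob_compl finite_measure_mono by (metis sets.compl_sets)
    with s mass show False by simp
  qed
qed

text \<open>If the support function is at most \<open>s\<close>, the halfspace \<open>{v \<bullet> u > s}\<close> has mass at most \<open>\<epsilon>\<close>, for
  otherwise its conditional mean would be a point of \<open>U_LCX\<close> in that halfspace.\<close>

lemma VaR_le_support_fun:
  fixes P :: "(real^'n) measure"
  assumes P: "P \<in> P_LCX N us \<Gamma>LCX \<Gamma>\<sigma>" and "0 \<le> \<Gamma>LCX" and \<epsilon>: "0 < \<epsilon>" "\<epsilon> < 1"
  shows "ereal (VaR P \<epsilon> v) \<le> support_fun v (U_LCX N us \<Gamma>LCX \<epsilon>)"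
proof (rule ereal_le_real)
  interpret prob_space P using P by (rule P_LCX_prob_space)
  have setsP: "sets P = sets borel" using P by (rule P_LCX_sets)
  fix s assume s: "support_fun v (U_LCX N us \<Gamma>LCX \<epsilon>) \<le> ereal s"
  define H where "H = {u. s < v \<bullet> u}"
  have "open H" unfolding H_def by (rule open_halfspace_gt)
  have "1 - \<epsilon> \<le> measure P {u. u \<bullet> v \<le> s}"
  proof (rule ccontr)
    assume "\<not> 1 - \<epsilon> \<le> measure P {u. u \<bullet> v \<le> s}"
    moreover have "{u. u \<bullet> v \<le> s} = space P - H"
      using sets_eq_imp_space_eq[OF setsP] by (auto simp: H_def inner_commute)
    ultimately have mass: "\<epsilon> < measure P H"
      using prob_compl[of H] \<open>open H\<close> setsP by simp
    have "s < v \<bullet> barycenter P H"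
    proof (rule barycenter_in_open_halfspace[OF prob_space_axioms setsP])
      show "integrable P (\<lambda>u. u)" using P \<open>0 \<le> \<Gamma>LCX\<close> by (rule P_LCX_integrable)
      show "H \<in> sets borel" using \<open>open H\<close> by simp
      show "0 < measure P H" using mass \<epsilon>(1) by linarith
    qed (simp add: H_def)
    moreover have "barycenter P H \<in> U_LCX N us \<Gamma>LCX \<epsilon>"
      using mass \<open>open H\<close> by (intro barycenter_in_U_LCX[OF assms(1-3)]) auto
    then have "ereal (v \<bullet> barycenter P H) \<le> support_fun v (U_LCX N us \<Gamma>LCX \<epsilon>)"
      unfolding support_fun_def by (rule SUP_upper)
    ultimately show False using s by (metis ereal_less_eq(3) linorder_not_less order_trans)
  qed
  then show "ereal (VaR P \<epsilon> v) \<le> ereal s"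
    unfolding VaR_def
    by (auto intro!: cInf_lower VaR_set(2)[OF prob_space_axioms setsP \<epsilon>])
qed

text \<open>A mass \<open>\<delta>\<close> at distance \<open>K\<close> from the origin costs at most \<open>\<delta> * (K + 1)\<close> in each of the first-order
  constraints but contributes \<open>\<delta> * K\<^sup>2\<close> to the second moment. At fixed cost \<open>s\<close> the contribution grows
  like \<open>s * K\<close>, and \<open>\<delta>\<close> tends to 0.\<close>

lemma far_atom_exists:
  fixes s \<eta> M :: real
  assumes "0 < s" "0 < \<eta>"
  obtains K \<delta> where "0 < K" "0 < \<delta>" "\<delta> < \<eta>" "\<delta> * (K + 1) = s" "M \<le> \<delta> * K\<^sup>2"
proof -
  define K where "K = 1 + s / \<eta> + \<bar>M\<bar> / s"
  define \<delta> where "\<delta> = s / (K + 1)"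
  have "1 \<le> K" using assms by (simp add: K_def)
  have 1: "s / \<eta> < K + 1" using assms by (simp add: K_def add_pos_nonneg)
  have "K - 1 \<le> K\<^sup>2 / (K + 1)"
    using \<open>1 \<le> K\<close> by (simp add: field_simps power2_eq_square)
  moreover have "\<bar>M\<bar> / s \<le> K - 1" using assms by (simp add: K_def)
  ultimately have "\<bar>M\<bar> / s \<le> K\<^sup>2 / (K + 1)" by linarith
  then have "M \<le> s * (K\<^sup>2 / (K + 1))"
    using assms by (simp add: pos_divide_le_eq mult.commute)
  then have "M \<le> \<delta> * K\<^sup>2" by (simp add: \<delta>_def)
  moreover have "\<delta> < \<eta>" using 1 assms \<open>1 \<le> K\<close> by (simp add: \<delta>_def field_simps)
  ultimately show thesis
    using that[of K \<delta>] assms \<open>1 \<le> K\<close> by (auto simp: \<delta>_def)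
qed

text \<open>Take mass \<open>1 / z > \<epsilon>\<close> at \<open>u\<close> and the rest at \<open>r / (z - 1)\<close>, both shrunk by the factor \<open>1 - \<delta>\<close>, and
  mass \<open>\<delta>\<close> far away. The slack \<open>\<gamma>\<close> of the constraints pays for the far atom, and the strict inequality
  \<open>z < 1 / \<epsilon>\<close> leaves room for the shrinking.\<close>

lemma strictly_feasible_point_le_VaR:
  fixes us :: "nat \<Rightarrow> real^'n"
  assumes "0 < \<epsilon>" "\<epsilon> < 1" "0 < \<Gamma>LCX" and z: "1 \<le> z" "z < 1 / \<epsilon>" and "0 < \<gamma>"
    and con: "\<And>a b. (a, b) \<in> B_set \<Longrightarrow>
      pos_part (a \<bullet> r - b * (z - 1)) + pos_part (a \<bullet> u - b) \<le> z * Gamma_fn N us \<Gamma>LCX a b - \<gamma>"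
  obtains P where "P \<in> P_LCX N us \<Gamma>LCX \<Gamma>\<sigma>" "v \<bullet> u \<le> VaR P \<epsilon> v"
proof -
  define M where "M = (1 / real N) * (\<Sum>j<N. (norm (us j))\<^sup>2) - \<Gamma>\<sigma>"
  have "0 < 1 - \<epsilon> * z" using z assms(1) by (simp add: field_simps)
  then obtain K \<delta> where K: "0 < K" "0 < \<delta>" "\<delta> < 1 - \<epsilon> * z" "\<delta> * (K + 1) = \<gamma> / z" "M \<le> \<delta> * K\<^sup>2"
    using far_atom_exists[of "\<gamma> / z" "1 - \<epsilon> * z" M] z \<open>0 < \<gamma>\<close> by auto
  have "0 \<le> \<epsilon> * z" using assms(1) z by simp
  then have "\<delta> < 1" using K by simp
  obtain h :: "real^'n" where h: "norm h = K" using vector_choose_size[of K] K(1) by auto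
  define I where "I = {0, 1, 2::nat}"
  define x where "x i = (if i = 0 then u else if i = 1 then (1 / (z - 1)) *\<^sub>R r else h)" for i :: nat
  define w where "w i = (if i = 0 then (1 - \<delta>) / z else if i = 1 then (1 - \<delta>) * (z - 1) / z else \<delta>)" for i :: nat
  have w: "0 \<le> w i" for i using z \<open>\<delta> < 1\<close> K by (simp add: w_def)
  define P where "P = atomic I w borel x"
  have I: "finite I" "x ` I \<subseteq> space borel" by (auto simp: I_def)
  have nnint: "(\<integral>\<^sup>+y. ennreal (f y) \<partial>P) = ennreal (\<Sum>i\<in>I. w i * f (x i))"
    if "f \<in> borel_measurable borel" "\<And>y. 0 \<le> f y" for f
    unfolding P_def using that w
    by (subst nn_integral_atomic[OF I]) (simp_all flip: ennreal_mult add: sum_ennreal)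
  have total: "(\<Sum>i\<in>I. w i) = 1"
    using z by (simp add: I_def w_def field_simps)
  have P: "prob_space P" "sets P = sets borel"
  proof
    show "emeasure P (space P) = 1"
      using nnint[of "\<lambda>_. 1"] total by simp
  qed (simp add: P_def)
  interpret prob_space P by fact
  have first: "(\<integral>\<^sup>+y. ennreal (pos_part (a \<bullet> y - b)) \<partial>P) \<le> ennreal (Gamma_fn N us \<Gamma>LCX a b)"
    if ab: "(a, b) \<in> B_set" for a b
  proof -
    define A where "A = pos_part (a \<bullet> u - b)"
    define C where "C = pos_part (a \<bullet> r - b * (z - 1))"
    \<comment> \<open>For \<open>z = 1\<close> the atom \<open>r / (z - 1)\<close> is the default value 0, but it carries no mass.\<close>
    have r: "(z - 1) * pos_part (a \<bullet> ((1 / (z - 1)) *\<^sub>R r) - b) \<le> C"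
    proof (cases "z = 1")
      case False
      then have "(z - 1) * (a \<bullet> ((1 / (z - 1)) *\<^sub>R r) - b) = a \<bullet> r - b * (z - 1)"
        by (simp add: field_simps)
      then show ?thesis using z by (simp add: C_def flip: pos_part_mult)
    qed (simp add: C_def)
    have "pos_part (a \<bullet> h - b) \<le> \<bar>a \<bullet> h\<bar> + \<bar>b\<bar>" by (simp add: pos_part_def)
    also have "\<dots> \<le> 1 * K + 1"
      using B_set_bounds[OF ab] Cauchy_Schwarz_ineq2[of a h] h K(1)
      by (intro add_mono order_trans[OF Cauchy_Schwarz_ineq2]) (auto intro: mult_right_mono)
    finally have hK: "pos_part (a \<bullet> h - b) \<le> K + 1" by simp
    have "(\<Sum>i\<in>I. w i * pos_part (a \<bullet> x i - b)) =
        (1 - \<delta>) / z * (A + (z - 1) * pos_part (a \<bullet> ((1 / (z - 1)) *\<^sub>R r) - b)) + \<delta> * pos_part (a \<bullet> h - b)"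
      by (simp add: I_def w_def x_def A_def algebra_simps add_divide_distrib diff_divide_distrib)
    also have "\<dots> \<le> (1 - \<delta>) / z * (A + C) + \<delta> * (K + 1)"
      using r hK K z \<open>\<delta> < 1\<close> by (intro add_mono mult_left_mono) auto
    also have "(1 - \<delta>) / z * (A + C) \<le> 1 / z * (A + C)"
      using K z by (intro mult_right_mono divide_right_mono) (auto simp: A_def C_def)
    also have "\<dots> \<le> 1 / z * (z * Gamma_fn N us \<Gamma>LCX a b - \<gamma>)"
      using con[OF ab] z by (intro mult_left_mono) (auto simp: A_def C_def)
    also have "\<dots> + \<delta> * (K + 1) = Gamma_fn N us \<Gamma>LCX a b"
      using z K(4) by (simp add: field_simps)
    finally have "(\<Sum>i\<in>I. w i * pos_part (a \<bullet> x i - b)) \<le> Gamma_fn N us \<Gamma>LCX a b" by simp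
    then show ?thesis by (subst nnint) (auto intro: ennreal_leI)
  qed
  have "M \<le> (\<Sum>i\<in>I. w i * (norm (x i))\<^sup>2)"
  proof -
    have "0 \<le> w 0 * (norm (x 0))\<^sup>2 + w 1 * (norm (x 1))\<^sup>2"
      using w by (intro add_nonneg_nonneg mult_nonneg_nonneg) auto
    moreover have "w 2 * (norm (x 2))\<^sup>2 = \<delta> * K\<^sup>2" by (simp add: w_def x_def h)
    ultimately show ?thesis using K(5) by (simp add: I_def)
  qed
  then have second: "ennreal M \<le> (\<integral>\<^sup>+y. ennreal ((norm y)\<^sup>2) \<partial>P)"
    by (subst nnint) (auto intro: ennreal_leI)
  have "P \<in> P_LCX N us \<Gamma>LCX \<Gamma>\<sigma>"
    unfolding P_LCX_def borel_prob_def using P first second by (auto simp: M_def)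
  moreover have "v \<bullet> u \<le> VaR P \<epsilon> v"
  proof (rule VaR_ge[OF P assms(1,2)])
    have m: "{y. v \<bullet> u \<le> y \<bullet> v} \<in> sets borel" by measurable
    have "\<epsilon> < (1 - \<delta>) / z" using K z by (simp add: field_simps)
    also have "(1 - \<delta>) / z \<le> measure P {y. v \<bullet> u \<le> y \<bullet> v}"
    proof -
      have "ennreal (w 0) * indicator {y. v \<bullet> u \<le> y \<bullet> v} (x 0)
          \<le> (\<Sum>i\<in>I. ennreal (w i) * indicator {y. v \<bullet> u \<le> y \<bullet> v} (x i))"
        by (rule member_le_sum) (auto simp: I_def)
      also have "\<dots> = emeasure P {y. v \<bullet> u \<le> y \<bullet> v}"
        unfolding P_def by (rule emeasure_atomic[OF I m, symmetric])
      finally show ?thesis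
        by (simp add: emeasure_eq_measure x_def w_def inner_commute)
    qed
    finally show "\<epsilon> < measure P {y. v \<bullet> u \<le> y \<bullet> v}" .
  qed
  ultimately show thesis by (rule that)
qed

text \<open>The constraints are jointly convex in \<open>(u, r, z)\<close>. On the segment from a feasible \<open>(u, r, z)\<close> to
  \<open>(m, 0, 1)\<close>, with \<open>m\<close> the sample mean, every point other than \<open>(u, r, z)\<close> itself has positive slack
  and \<open>z < 1 / \<epsilon>\<close>. Now let the point tend to \<open>u\<close>.\<close>

lemma support_fun_le_SUP_VaR:
  fixes us :: "nat \<Rightarrow> real^'n"
  assumes "N \<ge> 1" "0 < \<Gamma>LCX" "0 < \<epsilon>" "\<epsilon> < 1"
  shows "support_fun v (U_LCX N us \<Gamma>LCX \<epsilon>) \<le> (SUP P\<in>P_LCX N us \<Gamma>LCX \<Gamma>\<sigma>. ereal (VaR P \<epsilon> v))"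
    (is "_ \<le> ?S")
  unfolding support_fun_def
proof (rule SUP_least)
  fix u assume "u \<in> U_LCX N us \<Gamma>LCX \<epsilon>"
  then obtain r z where z: "1 \<le> z" "z \<le> 1 / \<epsilon>" and
    con: "\<And>a b. (a, b) \<in> B_set \<Longrightarrow>
        pos_part (a \<bullet> r - b * (z - 1)) + pos_part (a \<bullet> u - b) \<le> z * Gamma_fn N us \<Gamma>LCX a b"
    unfolding mem_U_LCX_iff by blast
  define m where "m = sample_mean N us"
  define ut where "ut t = (1 - t) *\<^sub>R u + t *\<^sub>R m" for t
  have le: "ereal (v \<bullet> ut t) \<le> ?S" if t: "0 < t" "t < 1" for t
  proof -
    define zt where "zt = (1 - t) * z + t"
    have "0 \<le> (1 - t) * (z - 1)" using z t by simp
    then have "1 \<le> zt" by (simp add: zt_def algebra_simps)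
    have "1 < 1 / \<epsilon>" using assms by simp
    have "0 \<le> (1 - t) * (1 / \<epsilon> - z)" "0 < t * (1 / \<epsilon> - 1)"
      using z t \<open>1 < 1 / \<epsilon>\<close> by auto
    then have "zt < 1 / \<epsilon>" by (simp add: zt_def algebra_simps diff_divide_distrib)
    have "pos_part (a \<bullet> ((1 - t) *\<^sub>R r) - b * (zt - 1)) + pos_part (a \<bullet> ut t - b)
        \<le> zt * Gamma_fn N us \<Gamma>LCX a b - t * \<Gamma>LCX" if ab: "(a, b) \<in> B_set" for a b
    proof -
      have "a \<bullet> ((1 - t) *\<^sub>R r) - b * (zt - 1) = (1 - t) * (a \<bullet> r - b * (z - 1))"
        by (simp add: zt_def algebra_simps)
      then have 1: "pos_part (a \<bullet> ((1 - t) *\<^sub>R r) - b * (zt - 1)) = (1 - t) * pos_part (a \<bullet> r - b * (z - 1))"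
        using t by (simp only: pos_part_mult diff_ge_0_iff_ge less_imp_le)
      have "a \<bullet> ut t - b = (1 - t) * (a \<bullet> u - b) + t * (a \<bullet> m - b)"
        by (simp add: ut_def inner_add_right algebra_simps)
      then have "pos_part (a \<bullet> ut t - b) \<le> pos_part ((1 - t) * (a \<bullet> u - b)) + pos_part (t * (a \<bullet> m - b))"
        by (simp only: pos_part_add_le)
      also have "\<dots> = (1 - t) * pos_part (a \<bullet> u - b) + t * pos_part (a \<bullet> m - b)"
        using t by (simp add: pos_part_mult)
      finally have 2: "pos_part (a \<bullet> ut t - b) \<le> \<dots>" .
      have 3: "(1 - t) * (pos_part (a \<bullet> r - b * (z - 1)) + pos_part (a \<bullet> u - b))
          \<le> (1 - t) * (z * Gamma_fn N us \<Gamma>LCX a b)"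
        using con[OF ab] t by (intro mult_left_mono) auto
      have "t * pos_part (a \<bullet> m - b) \<le> t * (Gamma_fn N us \<Gamma>LCX a b - \<Gamma>LCX)"
        using pos_part_sample_mean_le[OF assms(1)] t by (simp add: m_def)
      with 1 2 3 show ?thesis by (simp add: zt_def algebra_simps)
    qed
    then obtain P where "P \<in> P_LCX N us \<Gamma>LCX \<Gamma>\<sigma>" "v \<bullet> ut t \<le> VaR P \<epsilon> v"
      using strictly_feasible_point_le_VaR[OF assms(3,4,2) \<open>1 \<le> zt\<close> \<open>zt < 1 / \<epsilon>\<close>, of "t * \<Gamma>LCX"
          "(1 - t) *\<^sub>R r" "ut t" N us \<Gamma>\<sigma> v] t assms(2) by auto
    then show ?thesis by (intro SUP_upper2[of P]) auto
  qed
  have "((\<lambda>t. ereal (v \<bullet> ut t)) \<longlongrightarrow> ereal (v \<bullet> ut 0)) (at_right 0)"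
    unfolding ut_def by (intro tendsto_intros)
  moreover have "eventually (\<lambda>t. ereal (v \<bullet> ut t) \<le> ?S) (at_right 0)"
    using le by (intro eventually_at_rightI[of 0 1]) auto
  ultimately have "ereal (v \<bullet> ut 0) \<le> ?S"
    by (intro tendsto_upperbound) auto
  then show "ereal (v \<bullet> u) \<le> ?S" by (simp add: ut_def)
qed

section \<open>Weak duality\<close>

text \<open>A measure \<open>y\<close> dominated by \<open>l\<close> may be replaced by \<open>l\<close> once the integrand has been replaced by a
  nonnegative majorant. With \<open>g\<close> the positive part of \<open>f\<close>, this is how the constraint on the measures
  in the dual program is used.\<close>

lemma integral_minorant_le:
  fixes f g :: "'a \<Rightarrow> real"
  assumes "finite_measure l" and sets: "sets y = sets l"
    and le: "\<And>A. A \<in> sets l \<Longrightarrow> emeasure y A \<le> emeasure l A"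
    and [measurable]: "f \<in> borel_measurable l" "g \<in> borel_measurable l"
    and fg: "\<And>p. p \<in> space l \<Longrightarrow> f p \<le> g p" "\<And>p. p \<in> space l \<Longrightarrow> 0 \<le> g p"
    and int: "integrable y f" "integrable l g"
  shows "(\<integral>p. f p \<partial>y) \<le> (\<integral>p. g p \<partial>l)"
proof -
  have sp: "space y = space l" using sets by (rule sets_eq_imp_space_eq)
  have "y \<le> l" using le sets by (simp add: le_measure)
  then have nn: "(\<integral>\<^sup>+p. ennreal (g p) \<partial>y) \<le> (\<integral>\<^sup>+p. ennreal (g p) \<partial>l)"
    by (rule nn_integral_mono_measure[OF sets])
  have "g \<in> borel_measurable y" using assms(5) sets by (simp cong: measurable_cong_sets)
  have l: "(\<integral>\<^sup>+p. ennreal (g p) \<partial>l) = ennreal (\<integral>p. g p \<partial>l)"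
    using int(2) fg(2) by (intro nn_integral_eq_integral) auto
  with nn have fin: "(\<integral>\<^sup>+p. ennreal (g p) \<partial>y) < \<infinity>"
    by (metis ennreal_less_top infinity_ennreal_def order_le_less_trans)
  have gy: "integrable y g"
    using fin fg(2) sp \<open>g \<in> borel_measurable y\<close> by (intro integrableI_nonneg) auto
  have "(\<integral>p. f p \<partial>y) \<le> (\<integral>p. g p \<partial>y)"
    using fg(1) sp int gy by (intro integral_mono) auto
  also have "\<dots> \<le> (\<integral>p. g p \<partial>l)"
  proof -
    have "(\<integral>\<^sup>+p. ennreal (g p) \<partial>y) = ennreal (\<integral>p. g p \<partial>y)"
      using gy fg(2) sp by (intro nn_integral_eq_integral) auto
    moreover have "0 \<le> (\<integral>p. g p \<partial>l)" using fg(2) by (intro integral_nonneg_AE) auto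
    ultimately show ?thesis using nn l by simp
  qed
  finally show ?thesis .
qed

lemma integrable_continuous_on_compact_space:
  fixes f :: "'a::topological_space \<Rightarrow> 'b::{banach, second_countable_topology}"
  assumes "finite_measure m" "sets m = sets (restrict_space borel K)" "compact K"
    and "continuous_on K f"
  shows "integrable m f"
proof -
  have sp: "space m = K"
    using sets_eq_imp_space_eq[OF assms(2)] by (simp add: space_restrict_space)
  obtain B where "\<And>x. x \<in> K \<Longrightarrow> norm (f x) \<le> B"
    using compact_imp_bounded[OF compact_continuous_image[OF assms(4,3)]]
    by (auto simp: bounded_iff)
  moreover have "f \<in> borel_measurable m"
    using borel_measurable_continuous_on_restrict[OF assms(4)] assms(2)
    by (simp cong: measurable_cong_sets)
  ultimately show ?thesis
    using sp by (intro finite_measure.integrable_const_bound[OF assms(1), of _ B]) auto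
qed

text \<open>Integrate \<open>a \<bullet> u - b\<close> against \<open>y2\<close> and \<open>a \<bullet> r - b * (z - 1)\<close> against \<open>y1\<close>. The moment conditions
  turn the linear terms into \<open>v \<bullet> u\<close> and 0. Passing to positive parts and to \<open>l\<close>, the sum is bounded by
  the integral of the constraint that makes \<open>u\<close> a point of \<open>U_LCX\<close>. The bounds on \<open>z\<close> turn the
  resulting \<open>z * \<tau> - z * \<theta>\<close> into \<open>\<tau> / \<epsilon> - \<theta>\<close>.\<close>

lemma weak_duality:
  fixes us :: "nat \<Rightarrow> real^'n"
  assumes "0 < \<epsilon>" and u: "u \<in> U_LCX N us \<Gamma>LCX \<epsilon>"
    and feas: "dual_feasible N us \<Gamma>LCX v \<tau> \<theta> y1 y2 l"
  shows "v \<bullet> u \<le> dual_objective \<epsilon> \<tau> \<theta> y1 y2"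
proof -
  note feas = feas[unfolded dual_feasible_def B_measure_def case_prod_unfold]
  define R where "R = restrict_space (borel :: ((real^'n) \<times> real) measure) B_set"
  have sets: "sets y1 = sets R" "sets y2 = sets R" "sets l = sets R" and "finite_measure l"
    using feas by (auto simp: R_def)
  have sp: "space l = B_set"
    using sets_eq_imp_space_eq[OF sets(3)] by (simp add: R_def space_restrict_space)
  have fin: "finite_measure y" if "sets y = sets R" "\<forall>A\<in>sets R. emeasure y A \<le> emeasure l A" for y
  proof
    have "emeasure y (space y) \<le> emeasure l (space l)"
      using that sets by (metis sets.top sets_eq_imp_space_eq)
    then show "emeasure y (space y) \<noteq> \<infinity>"
      using finite_measure.emeasure_finite[OF \<open>finite_measure l\<close>] by (auto simp: top_unique)
  qed
  have fin1: "finite_measure y1" and fin2: "finite_measure y2"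
    using fin sets feas by (auto simp: R_def)
  note integrable = integrable_continuous_on_compact_space[OF _ _ compact_B_set]
  have int1: "integrable y1 f" and int2: "integrable y2 f" and intl: "integrable l f"
    if "continuous_on B_set f" for f :: "(real^'n) \<times> real \<Rightarrow> 'c::{banach, second_countable_topology}"
    using integrable[OF fin1 _ that] integrable[OF fin2 _ that] integrable[OF \<open>finite_measure l\<close> _ that] sets
    by (auto simp: R_def)
  have meas: "f \<in> borel_measurable l" if "continuous_on B_set f" for f :: "(real^'n) \<times> real \<Rightarrow> real"
    using intl[OF that] by auto
  obtain r z where z: "1 \<le> z" "z \<le> 1 / \<epsilon>" and
    con: "\<And>a b. (a, b) \<in> B_set \<Longrightarrow>
        pos_part (a \<bullet> r - b * (z - 1)) + pos_part (a \<bullet> u - b) \<le> z * Gamma_fn N us \<Gamma>LCX a b"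
    using u unfolding mem_U_LCX_iff by blast
  let ?g1 = "\<lambda>p. pos_part (fst p \<bullet> r - snd p * (z - 1))"
  let ?g2 = "\<lambda>p. pos_part (fst p \<bullet> u - snd p)"
  let ?b1 = "\<integral>p. snd p \<partial>y1" and ?b2 = "\<integral>p. snd p \<partial>y2"
  let ?G = "\<integral>p. Gamma_fn N us \<Gamma>LCX (fst p) (snd p) \<partial>l"
  have "(\<integral>p. fst p \<bullet> u - snd p \<partial>y2) = (\<integral>p. fst p \<partial>y2) \<bullet> u - ?b2"
  proof -
    have "(\<integral>p. fst p \<bullet> u - snd p \<partial>y2) = (\<integral>p. fst p \<bullet> u \<partial>y2) - (\<integral>p. snd p \<partial>y2)"
      by (intro Bochner_Integration.integral_diff int2 continuous_intros)
    moreover have "(\<integral>p. fst p \<bullet> u \<partial>y2) = (\<integral>p. fst p \<partial>y2) \<bullet> u"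
      by (intro integral_inner_left int2 continuous_intros)
    ultimately show ?thesis by simp
  qed
  moreover have "v = (\<integral>p. fst p \<partial>y2)" using feas by simp
  ultimately have "v \<bullet> u - ?b2 = (\<integral>p. fst p \<bullet> u - snd p \<partial>y2)" by simp
  also have "\<dots> \<le> (\<integral>p. ?g2 p \<partial>l)"
    using feas sets sp by (intro integral_minorant_le meas int2 intl continuous_intros pos_part_ge \<open>finite_measure l\<close>)
      (auto simp: R_def)
  finally have 2: "v \<bullet> u \<le> ?b2 + (\<integral>p. ?g2 p \<partial>l)" by simp
  have "(\<integral>p. fst p \<bullet> r - snd p * (z - 1) \<partial>y1) = (\<integral>p. fst p \<partial>y1) \<bullet> r - ?b1 * (z - 1)"
  proof -
    have "(\<integral>p. fst p \<bullet> r - snd p * (z - 1) \<partial>y1) = (\<integral>p. fst p \<bullet> r \<partial>y1) - (\<integral>p. snd p * (z - 1) \<partial>y1)"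
      by (intro Bochner_Integration.integral_diff int1 continuous_intros)
    moreover have "(\<integral>p. fst p \<bullet> r \<partial>y1) = (\<integral>p. fst p \<partial>y1) \<bullet> r"
      by (intro integral_inner_left int1 continuous_intros)
    ultimately show ?thesis by simp
  qed
  moreover have "(\<integral>p. fst p \<partial>y1) = 0" using feas by simp
  ultimately have "- ?b1 * (z - 1) = (\<integral>p. fst p \<bullet> r - snd p * (z - 1) \<partial>y1)" by simp
  also have "\<dots> \<le> (\<integral>p. ?g1 p \<partial>l)"
    using feas sets sp by (intro integral_minorant_le meas int1 intl continuous_intros pos_part_ge \<open>finite_measure l\<close>)
      (auto simp: R_def)
  finally have 1: "0 \<le> ?b1 * (z - 1) + (\<integral>p. ?g1 p \<partial>l)" by simp
  have "(\<integral>p. ?g1 p \<partial>l) + (\<integral>p. ?g2 p \<partial>l) = (\<integral>p. ?g1 p + ?g2 p \<partial>l)"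
    by (intro Bochner_Integration.integral_add[symmetric] intl continuous_intros)
  also have "\<dots> \<le> (\<integral>p. z * Gamma_fn N us \<Gamma>LCX (fst p) (snd p) \<partial>l)"
    using con sp by (intro integral_mono intl continuous_intros continuous_on_Gamma_fn) auto
  also have "\<dots> = z * ?G" by simp
  finally have 3: "(\<integral>p. ?g1 p \<partial>l) + (\<integral>p. ?g2 p \<partial>l) \<le> z * ?G" .
  have budget: "?G \<le> \<tau> - \<theta> - ?b1" and "0 \<le> \<tau>" "0 \<le> \<theta>" using feas by auto
  have "v \<bullet> u \<le> ?b2 + ?b1 * (z - 1) + z * (\<tau> - \<theta> - ?b1)"
    using 1 2 3 mult_left_mono[OF budget, of z] z(1) by linarith
  also have "\<dots> = z * \<tau> - z * \<theta> - ?b1 + ?b2" by (simp add: algebra_simps)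
  also have "\<dots> \<le> (1 / \<epsilon>) * \<tau> - \<theta> - ?b1 + ?b2"
    using mult_right_mono[OF z(2) \<open>0 \<le> \<tau>\<close>] mult_right_mono[OF z(1) \<open>0 \<le> \<theta>\<close>] by simp
  finally show ?thesis by (simp add: dual_objective_def case_prod_unfold)
qed

section \<open>Strong duality\<close>

text \<open>The pairs \<open>(v, s)\<close> for which the conclusion holds make up the cone generated by \<open>S\<close> and the
  trivial inequality \<open>0 \<le> 1\<close>. The Slater point puts the generators into an open halfspace, hence 0 is
  not in their compact convex hull and the cone is closed. Were \<open>(v, s)\<close> outside, a separating
  hyperplane would provide a point that violates the implication.\<close>

lemma semi_infinite_farkas:
  fixes S :: "('a::euclidean_space \<times> real) set"
  assumes "compact S"
    and slater: "\<And>c d. (c, d) \<in> S \<Longrightarrow> c \<bullet> x0 < d"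
    and imp: "\<And>x. (\<And>c d. (c, d) \<in> S \<Longrightarrow> c \<bullet> x \<le> d) \<Longrightarrow> v \<bullet> x \<le> s"
  obtains F w where "finite F" "F \<subseteq> S" "\<And>p. p \<in> F \<Longrightarrow> 0 \<le> w p"
    "v = (\<Sum>p\<in>F. w p *\<^sub>R fst p)" "(\<Sum>p\<in>F. w p * snd p) \<le> s"
proof -
  define S' where "S' = insert (0, 1) S"
  define C where "C = convex hull S'"
  define K where "K = conic hull C"
  have "compact C"
    unfolding C_def S'_def by (intro compact_convex_hull compact_insert assms)
  have "C \<subseteq> {p. (x0, -1) \<bullet> p < 0}"
    unfolding C_def S'_def using slater
    by (intro hull_minimal convex_halfspace_lt) (auto simp: inner_Pair inner_commute)
  then have "0 \<notin> C" by auto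
  have "closed K" unfolding K_def using \<open>compact C\<close> \<open>0 \<notin> C\<close> by (intro closed_conic_hull) simp
  have "convex K" unfolding K_def C_def by (intro convex_conic_hull convex_convex_hull)
  have K_scale: "k *\<^sub>R p \<in> K" if "p \<in> S'" "0 \<le> k" for k p
    using that hull_inc[of p S' convex] unfolding K_def C_def conic_hull_explicit by blast
  have "(v, s) \<in> K"
  proof (rule ccontr)
    assume "(v, s) \<notin> K"
    then obtain h \<beta> where h: "h \<bullet> (v, s) < \<beta>" "\<forall>p\<in>K. \<beta> < h \<bullet> p"
      using separating_hyperplane_closed_point[OF \<open>convex K\<close> \<open>closed K\<close>] by blast
    have "\<beta> < 0"
      using h(2) K_scale[of "(0,1)" 0] by (force simp: S'_def simp flip: zero_prod_def)
    have h_nonneg: "0 \<le> h \<bullet> p" if "p \<in> S'" for p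
    proof (rule ccontr)
      assume "\<not> 0 \<le> h \<bullet> p"
      then have neg: "h \<bullet> p < 0" by simp
      with K_scale[OF that, of "\<beta> / (h \<bullet> p)"] \<open>\<beta> < 0\<close> h(2) show False
        by (fastforce simp: divide_nonpos_neg)
    qed
    define x where "x = - fst h"
    define w where "w = snd h"
    have "0 \<le> w" using h_nonneg[of "(0,1)"] by (simp add: S'_def w_def inner_prod_def)
    have x_le: "c \<bullet> x \<le> w * d" if "(c, d) \<in> S" for c d
      using h_nonneg[of "(c, d)"] that by (simp add: S'_def x_def w_def inner_prod_def inner_commute)
    have x_v: "w * s - \<beta> < v \<bullet> x"
      using h(1) by (simp add: x_def w_def inner_prod_def inner_commute)
    define D where "D = s - v \<bullet> x0"
    have "0 \<le> D"
      using imp[of x0] slater by (force simp: D_def)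
    \<comment> \<open>If \<open>w = 0\<close>, then \<open>x\<close> is a recession direction and cannot be rescaled to a feasible point.
      Adding a small multiple of the Slater point makes the rescaling possible in both cases; the
      bound on \<open>\<eta>\<close> keeps the inequality violated.\<close>
    define \<eta> where "\<eta> = - \<beta> / (D + 1)"
    have "0 < \<eta>" using \<open>\<beta> < 0\<close> \<open>0 \<le> D\<close> by (simp add: \<eta>_def divide_neg_pos)
    have "\<eta> * D < - \<beta>"
      using \<open>\<beta> < 0\<close> \<open>0 \<le> D\<close> by (simp add: \<eta>_def field_simps)
    define t where "t = \<eta> + w"
    have "0 < t" using \<open>0 < \<eta>\<close> \<open>0 \<le> w\<close> by (simp add: t_def)
    define y where "y = inverse t *\<^sub>R (\<eta> *\<^sub>R x0 + x)"
    have y: "e \<bullet> y = (\<eta> * (e \<bullet> x0) + e \<bullet> x) / t" for e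
      by (simp add: y_def inner_add_right divide_inverse algebra_simps)
    have "v \<bullet> y \<le> s"
    proof (rule imp)
      fix c d assume cd: "(c, d) \<in> S"
      have "\<eta> * (c \<bullet> x0) + c \<bullet> x \<le> \<eta> * d + w * d"
        using slater[OF cd] x_le[OF cd] \<open>0 < \<eta>\<close>
        by (intro add_mono) auto
      then show "c \<bullet> y \<le> d"
        using \<open>0 < t\<close> by (simp add: y pos_divide_le_eq) (simp add: t_def algebra_simps)
    qed
    then have "\<eta> * (v \<bullet> x0) + v \<bullet> x \<le> s * t"
      using \<open>0 < t\<close> by (simp add: y pos_divide_le_eq)
    with x_v \<open>\<eta> * D < - \<beta>\<close> show False by (simp add: D_def t_def algebra_simps)
  qed
  then obtain k y where k: "0 \<le> k" "y \<in> C" "(v, s) = k *\<^sub>R y"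
    unfolding K_def conic_hull_explicit by blast
  then obtain G u where G: "finite G" "G \<subseteq> S'" "\<forall>p\<in>G. 0 \<le> u p" "(\<Sum>p\<in>G. u p *\<^sub>R p) = y"
    unfolding C_def convex_hull_explicit by blast
  define w where "w p = k * u p" for p
  have vs: "(v, s) = (\<Sum>p\<in>G. w p *\<^sub>R p)"
    unfolding k(3) G(4)[symmetric] w_def by (simp add: scaleR_sum_right)
  have w: "0 \<le> w p" if "p \<in> G" for p using that G k by (simp add: w_def)
  \<comment> \<open>The trivial inequality only contributes to the right-hand side and is dropped.\<close>
  let ?F = "G - {(0,1)}"
  have "v = (\<Sum>p\<in>G. w p *\<^sub>R fst p)" using arg_cong[OF vs, of fst] by (simp add: fst_sum)
  also have "\<dots> = (\<Sum>p\<in>?F. w p *\<^sub>R fst p)"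
    using \<open>finite G\<close> by (intro sum.mono_neutral_right) auto
  finally have "v = (\<Sum>p\<in>?F. w p *\<^sub>R fst p)" .
  moreover have "(\<Sum>p\<in>?F. w p * snd p) \<le> (\<Sum>p\<in>G. w p * snd p)"
    using \<open>finite G\<close> w by (intro sum_mono2) auto
  moreover have "(\<Sum>p\<in>G. w p * snd p) = s"
    using arg_cong[OF vs, of snd] by (simp add: snd_sum)
  ultimately show thesis
    using that[of ?F w] G w by (auto simp: S'_def)
qed

text \<open>The linear inequality \<open>c \<bullet> (u, r, z) \<le> d\<close>, given as the pair \<open>(c, d)\<close>, that arises from the
  constraint of \<open>U_LCX\<close> at \<open>p\<close> when the first positive part is replaced by its argument or by 0,
  according to the first component of \<open>k\<close>, and likewise the second.\<close>

definition cut ::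
  "nat \<Rightarrow> (nat \<Rightarrow> real^'n) \<Rightarrow> real \<Rightarrow> bool \<times> bool \<Rightarrow> (real^'n) \<times> real
    \<Rightarrow> ((real^'n) \<times> (real^'n) \<times> real) \<times> real" where
  "cut N us \<Gamma>LCX k p =
     ((of_bool (snd k) *\<^sub>R fst p, of_bool (fst k) *\<^sub>R fst p,
       - of_bool (fst k) * snd p - Gamma_fn N us \<Gamma>LCX (fst p) (snd p)),
      of_bool (snd k) * snd p - of_bool (fst k) * snd p)"

lemma cut_holds_iff:
  "fst (cut N us \<Gamma>LCX k (a, b)) \<bullet> (u, r, z) \<le> snd (cut N us \<Gamma>LCX k (a, b)) \<longleftrightarrow>
     of_bool (fst k) * (a \<bullet> r - b * (z - 1)) + of_bool (snd k) * (a \<bullet> u - b)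
       \<le> z * Gamma_fn N us \<Gamma>LCX a b"
  by (simp add: cut_def inner_Pair algebra_simps)

text \<open>The variables are \<open>(u, r, z)\<close>, the inequalities are all cuts together with \<open>z \<le> 1 / \<epsilon>\<close> and
  \<open>- z \<le> -1\<close>. In the combination for \<open>v \<bullet> u \<le> s\<close>, the multipliers of the two bounds on \<open>z\<close> are \<open>\<tau>\<close>
  and \<open>\<theta>\<close>, the multipliers of the cuts are the weights of \<open>l\<close>, and those of the cuts that keep the
  first or second positive part are the weights of \<open>y1\<close> or \<open>y2\<close>. Comparing the coefficients of
  \<open>u\<close>, \<open>r\<close> and \<open>z\<close> gives the constraints of the dual program; comparing right-hand sides gives the
  bound on its objective.\<close>

lemma dual_attained:
  fixes us :: "nat \<Rightarrow> real^'n"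
  assumes "N \<ge> 1" "\<Gamma>LCX > 0" "0 < \<epsilon>" "\<epsilon> < 1"
    and s: "\<And>u. u \<in> U_LCX N us \<Gamma>LCX \<epsilon> \<Longrightarrow> v \<bullet> u \<le> s"
  obtains \<tau> \<theta> y1 y2 l where "dual_feasible N us \<Gamma>LCX v \<tau> \<theta> y1 y2 l"
    "dual_objective \<epsilon> \<tau> \<theta> y1 y2 \<le> s"
proof -
  define Q where "Q = cut N us \<Gamma>LCX"
  define B where "B = (B_set :: ((real^'n) \<times> real) set)"
  define T where "T = (\<Union>k. Q k ` B)"
  define up :: "((real^'n) \<times> (real^'n) \<times> real) \<times> real" where "up = ((0, 0, 1), 1 / \<epsilon>)"
  define lo :: "((real^'n) \<times> (real^'n) \<times> real) \<times> real" where "lo = ((0, 0, -1), -1)"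
  have "up \<noteq> lo" by (simp add: up_def lo_def)
  have "compact T"
    unfolding T_def B_def Q_def cut_def
    by (intro compact_UN compact_continuous_image compact_B_set continuous_intros
        continuous_on_Gamma_fn) auto
  define z0 where "z0 = (1 + 1 / \<epsilon>) / 2"
  have z0: "1 < z0" "z0 < 1 / \<epsilon>" using assms(3,4) by (simp_all add: z0_def field_simps)
  define m where "m = sample_mean N us"
  \<comment> \<open>The Slater point has \<open>z\<close> strictly between its bounds and places both atoms at the mean.\<close>
  have slater: "c \<bullet> (m, (z0 - 1) *\<^sub>R m, z0) < d" if mem: "(c, d) \<in> insert up (insert lo T)" for c d
  proof -
    consider "(c, d) = up" | "(c, d) = lo" | "(c, d) \<in> T"
      using mem by blast
    then show ?thesis
    proof cases
      case 3
      then obtain k p where "(c, d) = Q k p" "p \<in> B"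
        unfolding T_def by blast
      moreover obtain a b where "p = (a, b)" by fastforce
      ultimately have cd: "(c, d) = Q k (a, b)" by simp
      have "of_bool (fst k) * (a \<bullet> ((z0 - 1) *\<^sub>R m) - b * (z0 - 1)) + of_bool (snd k) * (a \<bullet> m - b)
          \<le> pos_part ((z0 - 1) * (a \<bullet> m - b)) + pos_part (a \<bullet> m - b)"
        using of_bool_mult_le_pos_part[of "fst k" "(z0 - 1) * (a \<bullet> m - b)"]
          of_bool_mult_le_pos_part[of "snd k" "a \<bullet> m - b"]
        by (simp add: algebra_simps)
      also have "\<dots> = z0 * pos_part (a \<bullet> m - b)"
        using z0 by (subst pos_part_mult) (simp_all add: algebra_simps)
      also have "\<dots> \<le> z0 * (Gamma_fn N us \<Gamma>LCX a b - \<Gamma>LCX)"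
        using z0 pos_part_sample_mean_le[OF assms(1)] by (simp add: m_def)
      also have "\<dots> < z0 * Gamma_fn N us \<Gamma>LCX a b"
        using z0 assms(2) by simp
      finally have "fst (Q k (a, b)) \<bullet> (m, (z0 - 1) *\<^sub>R m, z0) < snd (Q k (a, b))"
        by (simp add: Q_def cut_def inner_Pair algebra_simps)
      then show ?thesis by (simp flip: cd)
    qed (use z0 in \<open>auto simp: up_def lo_def inner_Pair\<close>)
  qed
  have imp: "(v, 0, 0) \<bullet> x \<le> s"
    if x: "\<And>c d. (c, d) \<in> insert up (insert lo T) \<Longrightarrow> c \<bullet> x \<le> d" for x
  proof -
    obtain u r z where x_eq: "x = (u, r, z)" by (metis prod.exhaust)
    have "u \<in> U_LCX N us \<Gamma>LCX \<epsilon>"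
      unfolding mem_U_LCX_iff
    proof (intro exI conjI allI impI)
      show "1 \<le> z" "z \<le> 1 / \<epsilon>"
        using x[of "fst lo" "snd lo"] x[of "fst up" "snd up"]
        by (auto simp: x_eq lo_def up_def inner_Pair)
      fix a :: "real^'n" and b :: real
      assume ab: "(a, b) \<in> B_set"
      \<comment> \<open>The strongest of the four cuts keeps exactly the nonnegative arguments.\<close>
      let ?k = "(0 \<le> a \<bullet> r - b * (z - 1), 0 \<le> a \<bullet> u - b)"
      have "Q ?k (a, b) \<in> T" using ab unfolding T_def B_def by blast
      then have "fst (Q ?k (a, b)) \<bullet> (u, r, z) \<le> snd (Q ?k (a, b))"
        using x[of "fst (Q ?k (a, b))" "snd (Q ?k (a, b))"] by (simp add: x_eq)
      then show "pos_part (a \<bullet> r - b * (z - 1)) + pos_part (a \<bullet> u - b) \<le> z * Gamma_fn N us \<Gamma>LCX a b"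
        by (simp only: Q_def cut_holds_iff fst_conv snd_conv pos_part_eq_of_bool)
    qed
    from s[OF this] show ?thesis by (simp add: x_eq inner_Pair)
  qed
  have "compact (insert up (insert lo T))" using \<open>compact T\<close> by simp
  from semi_infinite_farkas[OF this slater imp]
  obtain F w where F: "finite F" "F \<subseteq> insert up (insert lo T)" "\<And>p. p \<in> F \<Longrightarrow> 0 \<le> w p"
    and F1: "(v, 0, 0) = (\<Sum>p\<in>F. w p *\<^sub>R fst p)" and F2: "(\<Sum>p\<in>F. w p * snd p) \<le> s"
    by blast
  define E where "E = F - {up, lo}"
  define \<tau> where "\<tau> = (if up \<in> F then w up else 0)"
  define \<theta> where "\<theta> = (if lo \<in> F then w lo else 0)"
  have "0 \<le> \<tau>" "0 \<le> \<theta>" using F(3) by (auto simp: \<tau>_def \<theta>_def)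
  have "finite E" "E \<subseteq> T" using F by (auto simp: E_def)
  have w: "0 \<le> w p" if "p \<in> E" for p using that F(3) by (simp add: E_def)
  have split_sum: "(\<Sum>p\<in>F. w p *\<^sub>R h p) = (\<Sum>p\<in>E. w p *\<^sub>R h p) + \<tau> *\<^sub>R h up + \<theta> *\<^sub>R h lo"
    for h :: "((real^'n) \<times> (real^'n) \<times> real) \<times> real \<Rightarrow> 'x::real_vector"
  proof -
    have "(\<Sum>p\<in>F. w p *\<^sub>R h p) = (\<Sum>p\<in>E. w p *\<^sub>R h p) + (\<Sum>p\<in>F \<inter> {up, lo}. w p *\<^sub>R h p)"
      using \<open>finite F\<close> unfolding E_def by (subst add.commute) (rule sum.Int_Diff)
    moreover have "(\<Sum>p\<in>F \<inter> {up, lo}. w p *\<^sub>R h p) = \<tau> *\<^sub>R h up + \<theta> *\<^sub>R h lo"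
      using \<open>up \<noteq> lo\<close> by (auto simp: \<tau>_def \<theta>_def Int_insert_right)
    ultimately show ?thesis by (simp add: add.assoc)
  qed
  have "\<forall>p\<in>E. \<exists>k q. p = Q k q \<and> q \<in> B"
    using \<open>E \<subseteq> T\<close> unfolding T_def by blast
  then obtain \<kappa> q where Qp: "\<And>p. p \<in> E \<Longrightarrow> p = Q (\<kappa> p) (q p)" "\<And>p. p \<in> E \<Longrightarrow> q p \<in> B"
    by metis
  define w1 where "w1 p = w p * of_bool (fst (\<kappa> p))" for p
  define w2 where "w2 p = w p * of_bool (snd (\<kappa> p))" for p
  have w12: "0 \<le> w1 p" "0 \<le> w2 p" "w1 p \<le> w p" "w2 p \<le> w p" if "p \<in> E" for p
    using w[OF that] by (auto simp: w1_def w2_def)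
  define R where "R = restrict_space (borel :: ((real^'n) \<times> real) measure) B_set"
  have img: "q ` E \<subseteq> space R" using Qp(2) by (auto simp: R_def B_def space_restrict_space)
  have meas: "f \<in> borel_measurable R" if "continuous_on UNIV f"
    for f :: "(real^'n) \<times> real \<Rightarrow> 'x::{banach, second_countable_topology}"
    unfolding R_def using that continuous_on_subset by (blast intro: borel_measurable_continuous_on_restrict)
  note atomic_int = integral_atomic[OF \<open>finite E\<close> img meas]
  define y1 y2 l where "y1 = atomic E w1 R q" and "y2 = atomic E w2 R q" and "l = atomic E w R q"
  have coord: "fst (fst p) = of_bool (snd (\<kappa> p)) *\<^sub>R fst (q p)"
    "fst (snd (fst p)) = of_bool (fst (\<kappa> p)) *\<^sub>R fst (q p)"
    "snd (snd (fst p)) = - of_bool (fst (\<kappa> p)) * snd (q p) - Gamma_fn N us \<Gamma>LCX (fst (q p)) (snd (q p))"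
    "snd p = of_bool (snd (\<kappa> p)) * snd (q p) - of_bool (fst (\<kappa> p)) * snd (q p)" if "p \<in> E" for p
    by (subst Qp(1)[OF that], simp add: Q_def cut_def)+
  have ints: "(\<integral>p. fst p \<partial>y1) = (\<Sum>p\<in>E. w1 p *\<^sub>R fst (q p))" "(\<integral>p. fst p \<partial>y2) = (\<Sum>p\<in>E. w2 p *\<^sub>R fst (q p))"
    "(\<integral>p. snd p \<partial>y1) = (\<Sum>p\<in>E. w1 p * snd (q p))" "(\<integral>p. snd p \<partial>y2) = (\<Sum>p\<in>E. w2 p * snd (q p))"
    "(\<integral>p. Gamma_fn N us \<Gamma>LCX (fst p) (snd p) \<partial>l) = (\<Sum>p\<in>E. w p * Gamma_fn N us \<Gamma>LCX (fst (q p)) (snd (q p)))"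
    unfolding y1_def y2_def l_def using w w12
    by (subst atomic_int; auto intro!: continuous_intros continuous_on_Gamma_fn)+
  have "v = (\<Sum>p\<in>F. w p *\<^sub>R fst (fst p))"
    using arg_cong[OF F1, of fst] by (simp add: fst_sum)
  then have v_eq: "v = (\<integral>p. fst p \<partial>y2)"
    unfolding split_sum ints by (simp add: up_def lo_def w2_def coord cong: sum.cong)
  have "0 = (\<Sum>p\<in>F. w p *\<^sub>R fst (snd (fst p)))"
    using arg_cong[OF F1, of "\<lambda>x. fst (snd x)"] by (simp add: fst_sum snd_sum)
  then have r_eq: "(\<integral>p. fst p \<partial>y1) = 0"
    unfolding split_sum ints by (simp add: up_def lo_def w1_def coord cong: sum.cong)
  have "0 = (\<Sum>p\<in>F. w p *\<^sub>R snd (snd (fst p)))"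
    using arg_cong[OF F1, of "\<lambda>x. snd (snd x)"] by (simp add: fst_sum snd_sum)
  then have "0 = (\<Sum>p\<in>E. w p * snd (snd (fst p))) + \<tau> - \<theta>"
    unfolding split_sum by (simp add: up_def lo_def)
  also have "(\<Sum>p\<in>E. w p * snd (snd (fst p))) =
      - (\<integral>p. snd p \<partial>y1) - (\<integral>p. Gamma_fn N us \<Gamma>LCX (fst p) (snd p) \<partial>l)"
    unfolding ints by (simp add: coord w1_def algebra_simps sum_subtractf sum_negf sum.distrib cong: sum.cong)
  finally have z_eq: "\<theta> + (\<integral>p. snd p \<partial>y1) + (\<integral>p. Gamma_fn N us \<Gamma>LCX (fst p) (snd p) \<partial>l) = \<tau>" by simp
  have "(\<Sum>p\<in>F. w p *\<^sub>R snd p) = (\<Sum>p\<in>E. w p * snd p) + \<tau> / \<epsilon> - \<theta>"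
    unfolding split_sum by (simp add: up_def lo_def)
  also have "(\<Sum>p\<in>E. w p * snd p) = (\<integral>p. snd p \<partial>y2) - (\<integral>p. snd p \<partial>y1)"
    unfolding ints by (simp add: coord w1_def w2_def algebra_simps sum_subtractf cong: sum.cong)
  finally have obj: "dual_objective \<epsilon> \<tau> \<theta> y1 y2 \<le> s"
    using F2 by (simp add: dual_objective_def case_prod_unfold)
  have le: "emeasure (atomic E w' R q) A \<le> emeasure l A"
    if "A \<in> sets R" "\<And>p. p \<in> E \<Longrightarrow> w' p \<le> w p" for w' A
    unfolding l_def using that
    by (simp add: emeasure_atomic[OF \<open>finite E\<close> img] sum_mono mult_right_mono ennreal_leI)
  have "finite_measure l"
  proof
    have "emeasure l (space R) = (\<Sum>p\<in>E. ennreal (w p) * indicator (space R) (q p))"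
      unfolding l_def by (rule emeasure_atomic[OF \<open>finite E\<close> img]) simp
    also have "\<dots> \<le> (\<Sum>p\<in>E. ennreal (w p))"
      by (intro sum_mono) (simp add: indicator_def)
    also have "\<dots> < \<infinity>" using \<open>finite E\<close> by (simp add: less_top[symmetric])
    finally show "emeasure l (space l) \<noteq> \<infinity>" by (simp add: l_def)
  qed
  moreover have "B_measure y1" "B_measure y2" "B_measure l"
    by (simp_all add: B_measure_def y1_def y2_def l_def R_def)
  ultimately have "dual_feasible N us \<Gamma>LCX v \<tau> \<theta> y1 y2 l"
    unfolding dual_feasible_def case_prod_unfold
    using v_eq r_eq z_eq \<open>0 \<le> \<tau>\<close> \<open>0 \<le> \<theta>\<close> le[of _ w1] le[of _ w2] w12
    by (auto simp: R_def y1_def y2_def)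
  with obj show thesis by (rule that[rotated])
qed

section \<open>Guarantee, values at risk and dual program\<close>

theorem theorem8:
  fixes Pstar :: "(real^'n) measure"
    and N :: nat
    and \<alpha> \<Gamma>LCX \<Gamma>\<sigma> :: real
  assumes "0 < \<alpha>" and "\<alpha> < 1"
    and "N \<ge> 1"
    and "borel_prob Pstar"
    and "\<Gamma>LCX > 0"
    and "with_prob_at_least (sampling N Pstar) (1 - \<alpha>) (\<lambda>us. Pstar \<in> P_LCX N us \<Gamma>LCX \<Gamma>\<sigma>)"
  shows "with_prob_at_least (sampling N Pstar) (1 - \<alpha>)
           (\<lambda>us. simultaneously_implies_guarantee TYPE('k::finite) Pstar
              (\<lambda>\<epsilon>. U_LCX N us \<Gamma>LCX \<epsilon>))
    \<and> (\<forall>(us :: nat \<Rightarrow> real^'n) (\<epsilon> :: real) (v :: real^'n). 0 < \<epsilon> \<and> \<epsilon> < 1 \<longrightarrow>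
         support_fun v (U_LCX N us \<Gamma>LCX \<epsilon>)
           = (SUP P\<in>P_LCX N us \<Gamma>LCX \<Gamma>\<sigma>. ereal (VaR P \<epsilon> v))
       \<and> (\<exists>m. is_minimum (dual_values N us \<Gamma>LCX \<epsilon> v) m
             \<and> support_fun v (U_LCX N us \<Gamma>LCX \<epsilon>) = ereal m))"
proof (intro conjI allI impI)
  have "simultaneously_implies_guarantee TYPE('k) Pstar (\<lambda>\<epsilon>. U_LCX N us \<Gamma>LCX \<epsilon>)"
    if "Pstar \<in> P_LCX N us \<Gamma>LCX \<Gamma>\<sigma>" for us
    unfolding simultaneously_implies_guarantee_def
    using implies_guarantee_U_LCX[OF that] assms(5) by auto
  then show "with_prob_at_least (sampling N Pstar) (1 - \<alpha>)
           (\<lambda>us. simultaneously_implies_guarantee TYPE('k::finite) Pstar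
              (\<lambda>\<epsilon>. U_LCX N us \<Gamma>LCX \<epsilon>))"
    using assms(6) unfolding with_prob_at_least_def by blast
next
  fix us :: "nat \<Rightarrow> real^'n" and \<epsilon> :: real and v :: "real^'n"
  assume "0 < \<epsilon> \<and> \<epsilon> < 1"
  then have \<epsilon>: "0 < \<epsilon>" "\<epsilon> < 1" by auto
  let ?U = "U_LCX N us \<Gamma>LCX \<epsilon>"
  show "support_fun v ?U = (SUP P\<in>P_LCX N us \<Gamma>LCX \<Gamma>\<sigma>. ereal (VaR P \<epsilon> v))"
    using assms(5) \<epsilon>
    by (intro antisym support_fun_le_SUP_VaR SUP_least VaR_le_support_fun[of _ N us \<Gamma>LCX \<Gamma>\<sigma>] assms(3)) auto
  define s where "s = (SUP u\<in>?U. v \<bullet> u)"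
  have "?U \<noteq> {}" using sample_mean_in_U_LCX[OF assms(3,5) \<epsilon>] by auto
  obtain K where K: "\<And>u. u \<in> ?U \<Longrightarrow> v \<bullet> u \<le> K"
    using U_LCX_inner_le[OF \<epsilon>(1) assms(5)] by blast
  then have "bdd_above ((\<lambda>u. v \<bullet> u) ` ?U)" by (rule bdd_aboveI2)
  then have s_upper: "v \<bullet> u \<le> s" if "u \<in> ?U" for u
    unfolding s_def using that by (intro cSUP_upper)
  have support: "support_fun v ?U = ereal s"
  proof (rule antisym)
    show "support_fun v ?U \<le> ereal s"
      unfolding support_fun_def using s_upper by (intro SUP_least) simp
    show "ereal s \<le> support_fun v ?U"
    proof (rule ereal_le_real)
      fix c assume "support_fun v ?U \<le> ereal c"
      then show "ereal s \<le> ereal c"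
        unfolding support_fun_def s_def using \<open>?U \<noteq> {}\<close> by (simp add: SUP_le_iff cSUP_least)
    qed
  qed
  have weak: "s \<le> m" if m: "m \<in> dual_values N us \<Gamma>LCX \<epsilon> v" for m
    unfolding s_def using m \<open>?U \<noteq> {}\<close>
    by (intro cSUP_least) (auto simp: dual_values_def intro: weak_duality[OF \<epsilon>(1)])
  obtain \<tau> \<theta> y1 y2 l where opt: "dual_feasible N us \<Gamma>LCX v \<tau> \<theta> y1 y2 l"
    "dual_objective \<epsilon> \<tau> \<theta> y1 y2 \<le> s"
    using dual_attained[OF assms(3,5) \<epsilon> s_upper] by blast
  have "dual_objective \<epsilon> \<tau> \<theta> y1 y2 \<in> dual_values N us \<Gamma>LCX \<epsilon> v"
    using opt(1) unfolding dual_values_def by blast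
  with opt(2) weak have "s \<in> dual_values N us \<Gamma>LCX \<epsilon> v" by force
  with weak support show "\<exists>m. is_minimum (dual_values N us \<Gamma>LCX \<epsilon> v) m \<and> support_fun v ?U = ereal m"
    unfolding is_minimum_def by blast
qed

end
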